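(* Let $0<\beta<1$ and let $p=p(N)$ satisfy $p^3N^2\to c\in(0,\infty)$ as $N\to\infty$. Then, as $N\to\infty$, $$\log Z_N(\beta)-N\log 2-\frac{\beta^2(1-p)}{8p}+\frac12\log(1-\beta)+\frac{\beta^4}{192c}\to\mathcal{N}\left(0,\frac{\beta^4}{64c}\right)$$ in distribution. In other words, $$\sqrt{1-\beta}\,\frac{Z_N(\beta)}{2^N e^{\frac{\beta^2(1-p)}{8p}-\frac{\beta^4}{192c}}}\to e^{\frac{\beta^2\xi}{8\sqrt c}}$$ in distribution, where $\xi$ is a standard normal random variable.
   Context: Ising model on a directed Erdős–Rényi graph: for each $N\in\mathbb{N}$ let $p=p(N)\in(0,1]$ and let $(\varepsilon_{i,j})_{i,j=1}^N$ be independent Bernoulli random variables (diagonal $i=j$ included, and $\varepsilon_{i,j}$, $\varepsilon_{j,i}$ are independent for $i\ne j$) with $\mathbb{P}(\varepsilon_{i,j}=1)=p=1-\mathbb{P}(\varepsilon_{i,j}=0)$. For $\sigma\in\{-1,+1\}^N$ put $H(\sigma)=-\frac{1}{2Np}\sum_{i,j=1}^N\sigma_i\sigma_j\varepsilon_{i,j}$, and for $\beta>0$ let $Z_N(\beta)=\sum_{\sigma\in\{-1,+1\}^N}\exp(-\beta H(\sigma))$ (a random variable). $\mathcal{N}(0,v)$ denotes the centered normal distribution with variance $v$. *)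

theory Defs
  imports "HOL-Probability.Probability"
begin

text \<open>
  Vertices are \<open>{1..N}\<close>. The edge indicators are indexed by ordered pairs with loops included, so
  \<open>\<epsilon> i j\<close> and \<open>\<epsilon> j i\<close> are independent for \<open>i \<noteq> j\<close>.
\<close>

definition directed_erdos_renyi ::
    "'a measure \<Rightarrow> nat \<Rightarrow> real \<Rightarrow> (nat \<Rightarrow> nat \<Rightarrow> 'a \<Rightarrow> real) \<Rightarrow> bool" where
  "directed_erdos_renyi M N p \<epsilon> \<longleftrightarrow>
     prob_space M \<and>
     prob_space.indep_vars M (\<lambda>_. borel) (\<lambda>(i, j). \<epsilon> i j) ({1..N} \<times> {1..N}) \<and>
     (\<forall>i\<in>{1..N}. \<forall>j\<in>{1..N}.
        measure M {\<omega> \<in> space M. \<epsilon> i j \<omega> = 1} = p \<and>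
        measure M {\<omega> \<in> space M. \<epsilon> i j \<omega> = 0} = 1 - p)"

definition spin_configs :: "nat \<Rightarrow> (nat \<Rightarrow> real) set" where
  "spin_configs N = {1..N} \<rightarrow>\<^sub>E {-1, 1}"

definition hamiltonian :: "nat \<Rightarrow> real \<Rightarrow> (nat \<Rightarrow> nat \<Rightarrow> real) \<Rightarrow> (nat \<Rightarrow> real) \<Rightarrow> real" where
  "hamiltonian N p e \<sigma> =
     - (1 / (2 * real N * p)) * (\<Sum>i=1..N. \<Sum>j=1..N. \<sigma> i * \<sigma> j * e i j)"

definition partition_function :: "nat \<Rightarrow> real \<Rightarrow> real \<Rightarrow> (nat \<Rightarrow> nat \<Rightarrow> real) \<Rightarrow> real" where
  "partition_function N p \<beta> e = (\<Sum>\<sigma>\<in>spin_configs N. exp (- \<beta> * hamiltonian N p e \<sigma>))"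

text \<open>The parameter \<open>v\<close> is the variance, whereas \<^const>\<open>normal_density\<close> takes the standard deviation.\<close>

definition centered_normal :: "real \<Rightarrow> real measure" where
  "centered_normal v = density lborel (normal_density 0 (sqrt v))"

end

theory Submission
  imports Defs "HOL-Real_Asymp.Real_Asymp"
begin

text \<open>
  Put \<open>\<gamma> = \<beta> / (2 N p)\<close>. For \<open>\<epsilon> \<in> {0, 1}\<close> and a sign \<open>x\<close> one has
  \<open>exp (\<gamma> x \<epsilon>) = (cosh \<gamma>)^\<epsilon> (1 + \<epsilon> x tanh \<gamma>)\<close>. Hence almost surely \<open>Z = 2^N (cosh \<gamma>)^S W\<close>, where \<open>S\<close> is the
  number of edges and \<open>W\<close> is the average over spin configurations of
  \<open>\<Prod> (1 + \<epsilon>\<^sub>i\<^sub>j \<sigma>\<^sub>i \<sigma>\<^sub>j tanh \<gamma>)\<close>.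

  All Gaussian fluctuations come from \<open>S ln (cosh \<gamma>)\<close>: its mean is
  \<open>\<beta>\<^sup>2 / (8 p) - \<beta>^4 / (192 c) + o(1)\<close> and its variance tends to \<open>\<beta>^4 / (64 c)\<close>. The factor \<open>W\<close> converges
  in \<open>L\<^sup>2\<close> to the constant \<open>exp (- \<beta>\<^sup>2 / 8) / sqrt (1 - \<beta>)\<close>, because its first two moments are
  Curie--Weiss partition functions, with effective inverse temperature tending to \<open>\<beta> < 1\<close> and a vanishing coupling
  between the two replicas.
\<close>

section \<open>Gaussian integrals and elementary limits\<close>

text \<open>On this scale \<open>ln Z\<close> keeps a fluctuation of order one, so a second-moment
  argument for \<open>Z\<close> itself fails; dividing out \<open>(cosh \<gamma>)^S\<close> removes
  the fluctuation carried by the number of edges, and the rest concentrates. The scale is dictated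
  by the exact identity \<open>N\<^sup>2 p \<gamma>^4 = \<beta>^4 / (16 p^3 N\<^sup>2)\<close>. With
  \<open>ln (cosh x) = x\<^sup>2 / 2 - x^4 / 12 + ...\<close>, the quadratic term contributes
  exactly \<open>\<beta>\<^sup>2 / (8 p)\<close> to the mean, the quartic term gives
  \<open>\<beta>^4 / (192 c)\<close>, and the squared quadratic term gives the variance. The
  centring \<open>\<beta>\<^sup>2 (1 - p) / (8 p)\<close> differs from this mean by
  \<open>\<beta>\<^sup>2 / 8\<close>, which is supplied by the limit of \<open>ln W\<close>.

  The hard estimate is the second moment of \<open>W\<close>, where two replicas live on one graph
  and interact through their overlap. An upper bound is enough, because the mean of
  \<open>(W - L)\<^sup>2\<close> is nonnegative; this permits convexity inequalities that lose an
  arbitrarily small amount.\<close>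

lemma tendsto_mult_ln_one_plus:
  fixes x k :: "nat \<Rightarrow> real"
  assumes x: "x \<longlonglongrightarrow> 0" and kx: "(\<lambda>n. k n * x n) \<longlonglongrightarrow> l"
  shows "(\<lambda>n. k n * ln (1 + x n)) \<longlonglongrightarrow> l"
proof -
  have small: "\<forall>\<^sub>F n in sequentially. \<bar>x n\<bar> < 1/2"
    using order_tendstoD(2)[OF tendsto_rabs[OF x], of "1/2"] by simp
  have "(\<lambda>n. k n * ln (1 + x n) - k n * x n) \<longlonglongrightarrow> 0"
  proof (rule Lim_null_comparison)
    have "(\<lambda>n. 2 * \<bar>k n * x n\<bar> * \<bar>x n\<bar>) \<longlonglongrightarrow> 2 * \<bar>l\<bar> * \<bar>0\<bar>"
      by (intro tendsto_intros x kx)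
    then show "(\<lambda>n. 2 * \<bar>k n * x n\<bar> * \<bar>x n\<bar>) \<longlonglongrightarrow> 0"
      by simp
    show "\<forall>\<^sub>F n in sequentially. norm (k n * ln (1 + x n) - k n * x n)
            \<le> 2 * \<bar>k n * x n\<bar> * \<bar>x n\<bar>"
      using small
    proof eventually_elim
      case (elim n)
      have "norm (k n * ln (1 + x n) - k n * x n) = \<bar>k n\<bar> * \<bar>ln (1 + x n) - x n\<bar>"
        unfolding right_diff_distrib[symmetric] by (simp add: abs_mult)
      also have "\<dots> \<le> \<bar>k n\<bar> * (2 * (x n)\<^sup>2)"
        using elim by (intro mult_left_mono[OF abs_ln_one_plus_x_minus_x_bound]) auto
      also have "\<dots> = 2 * \<bar>k n * x n\<bar> * \<bar>x n\<bar>"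
        by (simp add: power2_eq_square abs_mult)
      finally show ?case .
    qed
  qed
  from tendsto_add[OF this kx] show ?thesis
    by simp
qed

lemma tendsto_one_plus_power_exp:
  fixes x :: "nat \<Rightarrow> real" and k :: "nat \<Rightarrow> nat"
  assumes x: "x \<longlonglongrightarrow> 0" and kx: "(\<lambda>n. real (k n) * x n) \<longlonglongrightarrow> l"
  shows "(\<lambda>n. (1 + x n) ^ k n) \<longlonglongrightarrow> exp l"
proof (rule Lim_transform_eventually)
  show "(\<lambda>n. exp (real (k n) * ln (1 + x n))) \<longlonglongrightarrow> exp l"
    by (intro tendsto_exp tendsto_mult_ln_one_plus x kx)
  have "\<forall>\<^sub>F n in sequentially. \<bar>x n\<bar> < 1"
    using order_tendstoD(2)[OF tendsto_rabs[OF x], of 1] by simp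
  then show "\<forall>\<^sub>F n in sequentially. exp (real (k n) * ln (1 + x n)) = (1 + x n) ^ k n"
    by eventually_elim (auto simp: exp_of_nat_mult)
qed

lemma std_normal_exp_linear:
  "has_bochner_integral lborel (\<lambda>x. std_normal_density x * exp (u * x)) (exp (u\<^sup>2 / 2))"
proof -
  have "has_bochner_integral lborel (\<lambda>x. exp (u\<^sup>2 / 2) * normal_density u 1 x) (exp (u\<^sup>2 / 2) * 1)"
    by (intro has_bochner_integral_mult_right)
       (simp add: has_bochner_integral_iff)
  also have "(\<lambda>x. exp (u\<^sup>2 / 2) * normal_density u 1 x) = (\<lambda>x. std_normal_density x * exp (u * x))"
    by (auto simp: normal_density_def fun_eq_iff exp_add[symmetric] power2_eq_square field_simps)
  finally show ?thesis by simp
qed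

text \<open>Up to the factor \<open>s = 1 / sqrt (1 - 2 * b)\<close> the tilted density is again a
  centred Gaussian density, with standard deviation \<open>s\<close>. This is the origin of
  \<open>1 / sqrt (1 - \<beta>)\<close> in the limit.\<close>

lemma std_normal_exp_quadratic:
  assumes "b < 1/2"
  shows "has_bochner_integral lborel (\<lambda>x. std_normal_density x * exp (b * x\<^sup>2)) (1 / sqrt (1 - 2 * b))"
proof -
  define s where "s = 1 / sqrt (1 - 2 * b)"
  have s: "0 < s" "s\<^sup>2 = 1 / (1 - 2 * b)"
    using assms by (auto simp: s_def power_divide)
  have "has_bochner_integral lborel (\<lambda>x. s * normal_density 0 s x) (s * 1)"
    using s by (intro has_bochner_integral_mult_right) (simp add: has_bochner_integral_iff)
  also have "(\<lambda>x. s * normal_density 0 s x) = (\<lambda>x. std_normal_density x * exp (b * x\<^sup>2))"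
  proof
    fix x
    have "- (x\<^sup>2 / (2 * s\<^sup>2)) = - (x\<^sup>2 / 2) + b * x\<^sup>2"
      using assms by (simp add: s field_simps)
    moreover have "s / sqrt (2 * pi * s\<^sup>2) = 1 / sqrt (2 * pi)"
      using s(1) by (simp add: real_sqrt_mult)
    moreover have "s * normal_density 0 s x = s / sqrt (2 * pi * s\<^sup>2) * exp (- (x\<^sup>2 / (2 * s\<^sup>2)))"
      by (simp add: normal_density_def)
    ultimately show "s * normal_density 0 s x = std_normal_density x * exp (b * x\<^sup>2)"
      by (simp add: normal_density_def exp_add[symmetric])
  qed
  finally show ?thesis by (simp add: s_def)
qed

lemma tanh_le_self:
  fixes x :: real
  assumes "0 \<le> x"
  shows "tanh x \<le> x"
proof -
  have "0 - tanh 0 \<le> x - tanh x"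
    by (rule DERIV_nonneg_imp_nondecreasing[OF assms, where f="\<lambda>x. x - tanh x"])
       (auto intro!: exI derivative_eq_intros simp: cosh_real_nonzero)
  then show ?thesis by simp
qed

text \<open>On \<open>x \<ge> 0\<close> the function \<open>x\<^sup>2 / 2 - ln (cosh x)\<close>
  starts at 0 and has derivative \<open>x - tanh x \<ge> 0\<close>. The bound provides the majorant
  for dominated convergence.\<close>

lemma cosh_le_exp_half_square: "cosh (x::real) \<le> exp (x\<^sup>2 / 2)"
proof -
  have pos: "cosh y \<le> exp (y\<^sup>2 / 2)" if "0 \<le> y" for y :: real
  proof -
    have "0\<^sup>2 / 2 - ln (cosh 0) \<le> y\<^sup>2 / 2 - ln (cosh y)"
    proof (rule DERIV_nonneg_imp_nondecreasing[OF that, where f="\<lambda>x. x\<^sup>2 / 2 - ln (cosh x)"])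
      fix z :: real
      assume "0 \<le> z"
      have "((\<lambda>x. x\<^sup>2 / 2 - ln (cosh x)) has_real_derivative z - tanh z) (at z)"
        by (auto intro!: derivative_eq_intros simp: cosh_real_pos tanh_def)
      with tanh_le_self[OF \<open>0 \<le> z\<close>]
      show "\<exists>d. ((\<lambda>x. x\<^sup>2 / 2 - ln (cosh x)) has_real_derivative d) (at z) \<and> 0 \<le> d"
        by (intro exI[of _ "z - tanh z"]) simp
    qed
    then have "exp (ln (cosh y)) \<le> exp (y\<^sup>2 / 2)"
      by (simp only: exp_le_cancel_iff) simp
    then show ?thesis
      by (simp add: cosh_real_pos)
  qed
  show ?thesis
    using pos[of "\<bar>x\<bar>"] by simp
qed

section \<open>Characteristic functions and weak convergence\<close>

text \<open>Both exponentials are replaced by quadratic Taylor polynomials. Centring cancels the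
  linear terms, and the quadratic ones add up to the variance \<open>p * (1 - p)\<close>. The factor
  \<open>p\<close> in the error matters: later \<open>k * p * u\<^sup>2\<close> is bounded, whereas
  \<open>k * u\<^sup>2\<close> need not be.\<close>

lemma centered_bernoulli_char_approx:
  fixes p u :: real
  assumes p: "0 \<le> p" "p \<le> 1"
  shows "cmod (((1 - p) *\<^sub>R iexp (- (u * p)) + p *\<^sub>R iexp (u * (1 - p))) - of_real (1 - u\<^sup>2 * p * (1 - p) / 2))
           \<le> p * \<bar>u\<bar> ^ 3"
proof -
  have approx: "cmod (iexp x - (1 + \<i> * x - (of_real x)\<^sup>2 / 2)) \<le> \<bar>x\<bar> ^ 3 / 6" for x
    using iexp_approx1[of x 2]
    by (simp add: eval_nat_numeral power_mult_distrib algebra_simps)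
  let ?x = "- (u * p)" and ?y = "u * (1 - p)"
  have "((1 - p) *\<^sub>R iexp ?x + p *\<^sub>R iexp ?y) - of_real (1 - u\<^sup>2 * p * (1 - p) / 2)
      = (1 - p) *\<^sub>R (iexp ?x - (1 + \<i> * ?x - (of_real ?x)\<^sup>2 / 2)) + p *\<^sub>R (iexp ?y - (1 + \<i> * ?y - (of_real ?y)\<^sup>2 / 2))"
    by (simp add: scaleR_conv_of_real field_simps power2_eq_square)
  also have "cmod \<dots> \<le> (1 - p) * (\<bar>?x\<bar> ^ 3 / 6) + p * (\<bar>?y\<bar> ^ 3 / 6)"
    using p by (intro order_trans[OF norm_triangle_ineq] add_mono)
      (auto simp only: norm_scaleR abs_of_nonneg diff_ge_0_iff_ge intro!: mult_left_mono approx)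
  also have "\<dots> = p * \<bar>u\<bar> ^ 3 * ((1 - p) * p\<^sup>2 / 6 + (1 - p) ^ 3 / 6)"
  proof -
    have abs: "\<bar>?x\<bar> = \<bar>u\<bar> * p" "\<bar>?y\<bar> = \<bar>u\<bar> * (1 - p)"
      using p by (simp_all add: abs_mult)
    show ?thesis
      unfolding abs by (simp add: power_mult_distrib eval_nat_numeral algebra_simps)
  qed
  also have "\<dots> \<le> p * \<bar>u\<bar> ^ 3 * 1"
  proof (intro mult_left_mono)
    have "(1 - p) * p\<^sup>2 \<le> 1 * 1" using p by (intro mult_mono power_le_one) auto
    moreover have "(1 - p) ^ 3 \<le> 1" using p by (intro power_le_one) auto
    ultimately show "(1 - p) * p\<^sup>2 / 6 + (1 - p) ^ 3 / 6 \<le> 1" by simp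
  qed (use p in auto)
  finally show ?thesis by simp
qed

text \<open>A triangular-array central limit theorem. Both bases eventually have modulus at most
  one, so their powers differ by at most \<open>k\<close> times the difference of the bases, hence
  by \<open>k * p * u\<^sup>2 * |u|\<close>. As \<open>p\<close> tends to 0, the factor
  \<open>1 - p\<close> of the variance drops out.\<close>

lemma centered_bernoulli_char_power_tendsto:
  fixes p u :: "nat \<Rightarrow> real" and k :: "nat \<Rightarrow> nat"
  assumes p: "\<And>n. n > 0 \<Longrightarrow> 0 \<le> p n \<and> p n \<le> 1" and p0: "p \<longlonglongrightarrow> 0" and u0: "u \<longlonglongrightarrow> 0"
    and v: "(\<lambda>n. real (k n) * p n * (u n)\<^sup>2) \<longlonglongrightarrow> v"
  shows "(\<lambda>n. ((1 - p n) *\<^sub>R iexp (- (u n * p n)) + p n *\<^sub>R iexp (u n * (1 - p n))) ^ k n)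
           \<longlonglongrightarrow> of_real (exp (- v / 2))"
proof -
  define \<psi> where "\<psi> n = (1 - p n) *\<^sub>R iexp (- (u n * p n)) + p n *\<^sub>R iexp (u n * (1 - p n))" for n
  define r where "r n = 1 + - ((u n)\<^sup>2 * p n * (1 - p n) / 2)" for n
  have "(\<lambda>n. - ((u n)\<^sup>2 * p n * (1 - p n) / 2)) \<longlonglongrightarrow> - (0\<^sup>2 * 0 * (1 - 0) / 2)"
    by (intro tendsto_intros p0 u0) auto
  then have s0: "(\<lambda>n. - ((u n)\<^sup>2 * p n * (1 - p n) / 2)) \<longlonglongrightarrow> 0" by simp
  have "(\<lambda>n. - (real (k n) * p n * (u n)\<^sup>2 * (1 - p n) / 2)) \<longlonglongrightarrow> - (v * (1 - 0) / 2)"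
    by (intro tendsto_intros v p0) auto
  then have ks: "(\<lambda>n. real (k n) * (- ((u n)\<^sup>2 * p n * (1 - p n) / 2))) \<longlonglongrightarrow> - v / 2"
    by (simp add: mult_ac)
  have "(\<lambda>n. r n ^ k n) \<longlonglongrightarrow> exp (- v / 2)"
    unfolding r_def by (rule tendsto_one_plus_power_exp[OF s0 ks])
  then have lim: "(\<lambda>n. of_real (r n) ^ k n :: complex) \<longlonglongrightarrow> of_real (exp (- v / 2))"
    unfolding of_real_power[symmetric] by (rule tendsto_of_real)
  have "(\<lambda>n. \<psi> n ^ k n - of_real (r n) ^ k n) \<longlonglongrightarrow> 0"
  proof (rule Lim_null_comparison)
    have "(\<lambda>n. real (k n) * p n * (u n)\<^sup>2 * \<bar>u n\<bar>) \<longlonglongrightarrow> v * \<bar>0\<bar>"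
      by (intro tendsto_intros v u0)
    then show "(\<lambda>n. real (k n) * p n * (u n)\<^sup>2 * \<bar>u n\<bar>) \<longlonglongrightarrow> 0" by simp
    have "\<forall>\<^sub>F n in sequentially. \<bar>- ((u n)\<^sup>2 * p n * (1 - p n) / 2)\<bar> < 1"
      using order_tendstoD(2)[OF tendsto_rabs[OF s0], of 1] by simp
    then show "\<forall>\<^sub>F n in sequentially. cmod (\<psi> n ^ k n - of_real (r n) ^ k n) \<le> real (k n) * p n * (u n)\<^sup>2 * \<bar>u n\<bar>"
      using eventually_gt_at_top[of 0]
    proof eventually_elim
      case (elim n)
      note pn = p[OF elim(2)]
      have "0 \<le> (u n)\<^sup>2 * p n * (1 - p n) / 2" using pn by simp
      then have r1: "cmod (of_real (r n)) \<le> 1"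
        using elim(1) unfolding norm_of_real r_def by linarith
      have "cmod (\<psi> n) \<le> (1 - p n) * 1 + p n * 1"
        unfolding \<psi>_def using pn
        by (intro order_trans[OF norm_triangle_ineq] add_mono) (simp_all del: of_real_minus of_real_mult of_real_diff)
      then have "cmod (\<psi> n) \<le> 1" by simp
      then have "cmod (\<psi> n ^ k n - of_real (r n) ^ k n) \<le> real (k n) * cmod (\<psi> n - of_real (r n))"
        using r1 by (rule norm_power_diff)
      also have "\<dots> \<le> real (k n) * (p n * \<bar>u n\<bar> ^ 3)"
        using centered_bernoulli_char_approx[of "p n" "u n"] pn
        unfolding \<psi>_def r_def by (intro mult_left_mono) auto
      also have "\<dots> = real (k n) * p n * (u n)\<^sup>2 * \<bar>u n\<bar>"
        by (simp add: eval_nat_numeral mult_ac)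
      finally show ?case .
    qed
  qed
  from tendsto_add[OF this lim] show ?thesis
    by (simp add: \<psi>_def)
qed

text \<open>Slutsky's theorem for sums, phrased with characteristic functions so that Levy's
  continuity theorem applies afterwards. Where \<open>|Y| < \<delta>\<close> the exponentials differ
  by at most \<open>|\<theta>| * \<delta>\<close>, elsewhere by at most 2.\<close>

lemma char_tendsto_slutsky:
  fixes M :: "nat \<Rightarrow> 'a measure" and X Y :: "nat \<Rightarrow> 'a \<Rightarrow> real"
  assumes M: "\<And>n. n > 0 \<Longrightarrow> prob_space (M n)"
    and X: "\<And>n. n > 0 \<Longrightarrow> X n \<in> borel_measurable (M n)"
    and Y: "\<And>n. n > 0 \<Longrightarrow> Y n \<in> borel_measurable (M n)"
    and X_lim: "(\<lambda>n. char (distr (M n) borel (X n)) \<theta>) \<longlonglongrightarrow> L"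
    and Y_lim: "\<And>\<delta>. \<delta> > 0 \<Longrightarrow> (\<lambda>n. measure (M n) {\<omega> \<in> space (M n). \<delta> \<le> \<bar>Y n \<omega>\<bar>}) \<longlonglongrightarrow> 0"
  shows "(\<lambda>n. char (distr (M n) borel (\<lambda>\<omega>. X n \<omega> + Y n \<omega>)) \<theta>) \<longlonglongrightarrow> L"
proof -
  let ?D = "\<lambda>n. char (distr (M n) borel (\<lambda>\<omega>. X n \<omega> + Y n \<omega>)) \<theta> - char (distr (M n) borel (X n)) \<theta>"
  have bound: "cmod (?D n) \<le> \<bar>\<theta>\<bar> * \<delta> + 2 * measure (M n) {\<omega> \<in> space (M n). \<delta> \<le> \<bar>Y n \<omega>\<bar>}"
    if n: "n > 0" and \<delta>: "\<delta> > 0" for n \<delta>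
  proof -
    interpret prob_space "M n" by (rule M[OF n])
    note [measurable] = X[OF n] Y[OF n]
    let ?A = "{\<omega> \<in> space (M n). \<delta> \<le> \<bar>Y n \<omega>\<bar>}"
    have int: "integrable (M n) (\<lambda>\<omega>. iexp (\<theta> * (X n \<omega> + Y n \<omega>)))" "integrable (M n) (\<lambda>\<omega>. iexp (\<theta> * X n \<omega>))"
      by (auto intro!: integrable_iexp)
    have "?D n = (CLINT \<omega>|M n. iexp (\<theta> * (X n \<omega> + Y n \<omega>)) - iexp (\<theta> * X n \<omega>))"
      unfolding char_def
      by (subst (1 2) integral_distr) (auto simp: Bochner_Integration.integral_diff[OF int] simp del: of_real_mult of_real_add)
    also have "cmod \<dots> \<le> (\<integral>\<omega>. cmod (iexp (\<theta> * (X n \<omega> + Y n \<omega>)) - iexp (\<theta> * X n \<omega>)) \<partial>M n)"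
      by (rule integral_norm_bound)
    also have "\<dots> \<le> (\<integral>\<omega>. \<bar>\<theta>\<bar> * \<delta> + 2 * indicator ?A \<omega> \<partial>M n)"
    proof (rule integral_mono)
      show "integrable (M n) (\<lambda>\<omega>. cmod (iexp (\<theta> * (X n \<omega> + Y n \<omega>)) - iexp (\<theta> * X n \<omega>)))"
        by (intro integrable_norm Bochner_Integration.integrable_diff int)
      show "integrable (M n) (\<lambda>\<omega>. \<bar>\<theta>\<bar> * \<delta> + 2 * indicator ?A \<omega>)"
        by (auto intro!: integrable_add integrable_mult_right simp: emeasure_eq_measure)
      fix \<omega> assume \<omega>: "\<omega> \<in> space (M n)"
      have "iexp (\<theta> * (X n \<omega> + Y n \<omega>)) - iexp (\<theta> * X n \<omega>) = iexp (\<theta> * X n \<omega>) * (iexp (\<theta> * Y n \<omega>) - 1)"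
        by (simp add: algebra_simps exp_add)
      then have eq: "cmod (iexp (\<theta> * (X n \<omega> + Y n \<omega>)) - iexp (\<theta> * X n \<omega>)) = cmod (iexp (\<theta> * Y n \<omega>) - 1)"
        by (simp only: norm_mult norm_exp_i_times mult_1)
      have "cmod (iexp (\<theta> * Y n \<omega>) - 1) \<le> \<bar>\<theta> * Y n \<omega>\<bar>" "cmod (iexp (\<theta> * Y n \<omega>) - 1) \<le> 2"
        using iexp_approx1[of "\<theta> * Y n \<omega>" 0] iexp_approx2[of "\<theta> * Y n \<omega>" 0] by simp_all
      moreover have "\<bar>\<theta> * Y n \<omega>\<bar> \<le> \<bar>\<theta>\<bar> * \<delta>" if "\<bar>Y n \<omega>\<bar> < \<delta>"
        using that by (simp add: abs_mult mult_left_mono)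
      ultimately show "cmod (iexp (\<theta> * (X n \<omega> + Y n \<omega>)) - iexp (\<theta> * X n \<omega>)) \<le> \<bar>\<theta>\<bar> * \<delta> + 2 * indicator ?A \<omega>"
        unfolding eq using \<omega> \<delta> by (cases "\<bar>Y n \<omega>\<bar> < \<delta>") (auto simp: indicator_def intro: order_trans)
    qed
    also have "\<dots> = \<bar>\<theta>\<bar> * \<delta> + 2 * measure (M n) ?A"
      by (subst Bochner_Integration.integral_add) (auto simp: prob_space emeasure_eq_measure)
    finally show ?thesis .
  qed
  have "?D \<longlonglongrightarrow> 0"
  proof (rule tendstoI)
    fix e :: real assume e: "e > 0"
    \<comment> \<open>The added 1 covers \<open>\<theta> = 0\<close> and makes
      \<open>|\<theta>| * \<delta> < e / 2\<close> strict.\<close>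
    define \<delta> where "\<delta> = e / (2 * (\<bar>\<theta>\<bar> + 1))"
    have \<delta>: "\<delta> > 0" using e by (simp add: \<delta>_def)
    have th: "\<bar>\<theta>\<bar> * \<delta> < e / 2"
      using e by (simp add: \<delta>_def field_simps)
    have "\<forall>\<^sub>F n in sequentially. measure (M n) {\<omega> \<in> space (M n). \<delta> \<le> \<bar>Y n \<omega>\<bar>} < e / 4"
      using e by (intro order_tendstoD(2)[OF Y_lim[OF \<delta>]]) auto
    then show "\<forall>\<^sub>F n in sequentially. dist (?D n) 0 < e"
      using eventually_gt_at_top[of 0]
    proof eventually_elim
      case (elim n)
      then show ?case
        using bound[OF elim(2) \<delta>] th by (simp only: dist_norm diff_zero)
    qed
  qed
  from tendsto_add[OF this X_lim] show ?thesis by simp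
qed

text \<open>The random graph is constrained only for \<open>N \<ge> 1\<close>, so the law at index 0
  must be exchangeable at will.\<close>

lemma weak_conv_m_cong_pos:
  assumes "\<And>n. n > 0 \<Longrightarrow> \<mu> n = \<nu> n" "weak_conv_m \<mu> \<kappa>"
  shows "weak_conv_m \<nu> \<kappa>"
proof -
  have "\<forall>\<^sub>F n in sequentially. cdf (\<mu> n) x = cdf (\<nu> n) x" for x
    using eventually_gt_at_top[of 0] by eventually_elim (simp add: assms(1))
  then show ?thesis
    using assms(2) unfolding weak_conv_m_def weak_conv_def
    by (auto intro: Lim_transform_eventually)
qed

text \<open>Continuous mapping theorem: composing a bounded continuous test function with
  \<open>g\<close> gives another one.\<close>

lemma weak_conv_m_distr_continuous:
  assumes \<mu>: "\<And>n. real_distribution (\<mu> n)" and \<kappa>: "real_distribution \<kappa>"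
    and conv: "weak_conv_m \<mu> \<kappa>" and g: "\<And>x. isCont g x"
  shows "weak_conv_m (\<lambda>n. distr (\<mu> n) borel g) (distr \<kappa> borel g)"
proof -
  have [measurable]: "g \<in> borel_measurable borel"
    using g by (intro borel_measurable_continuous_onI continuous_at_imp_continuous_on) auto
  interpret \<mu>: real_distribution "\<mu> n" for n by fact
  interpret \<kappa>: real_distribution \<kappa> by fact
  show ?thesis
  proof (rule integral_bdd_continuous_conv_imp_weak_conv)
    fix f :: "real \<Rightarrow> real"
    assume f: "\<And>x. isCont f x" "\<And>x. \<bar>f x\<bar> \<le> 1"
    have [measurable]: "f \<in> borel_measurable borel"
      using f by (intro borel_measurable_continuous_onI continuous_at_imp_continuous_on) auto
    have "(\<lambda>n. \<integral>x. f (g x) \<partial>\<mu> n) \<longlonglongrightarrow> (\<integral>x. f (g x) \<partial>\<kappa>)"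
      by (rule weak_conv_imp_integral_bdd_continuous_conv[OF \<mu> \<kappa> conv, where B=1])
         (auto intro: isCont_o2[OF g f(1)] simp: f(2))
    then show "(\<lambda>n. integral\<^sup>L (distr (\<mu> n) borel g) f) \<longlonglongrightarrow> integral\<^sup>L (distr \<kappa> borel g) f"
      by (simp add: integral_distr)
  qed (auto intro!: \<mu>.real_distribution_distr \<kappa>.real_distribution_distr)
qed

lemma centered_normal_eq_distr:
  assumes "0 < v"
  shows "centered_normal v = distr std_normal_distribution borel (\<lambda>x. sqrt v * x)"
proof -
  interpret prob_space std_normal_distribution
    by (rule prob_space_normal_density) simp
  have "distributed std_normal_distribution lborel (\<lambda>x. x) (normal_density 0 1)"
    by (auto simp: distributed_def distr_id2 cong: distr_cong)
  from normal_density_affine[OF this, of "sqrt v" 0]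
  have "distributed std_normal_distribution lborel (\<lambda>x. sqrt v * x) (normal_density 0 (sqrt v))"
    using assms by simp
  then have "distr std_normal_distribution lborel (\<lambda>x. sqrt v * x) = centered_normal v"
    by (simp add: distributed_def centered_normal_def)
  moreover have "distr std_normal_distribution lborel (\<lambda>x. sqrt v * x)
      = distr std_normal_distribution borel (\<lambda>x. sqrt v * x)"
    by (rule distr_cong) auto
  ultimately show ?thesis by simp
qed

lemma char_centered_normal:
  assumes "0 < v"
  shows "char (centered_normal v) \<theta> = of_real (exp (- (\<theta>\<^sup>2 * v) / 2))"
proof -
  have "char (centered_normal v) \<theta> = char std_normal_distribution (\<theta> * sqrt v)"
    unfolding centered_normal_eq_distr[OF assms] char_def
    by (subst integral_distr) (auto simp: mult_ac)
  also have "\<dots> = of_real (exp (- (\<theta>\<^sup>2 * v) / 2))"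
    using assms by (simp add: char_std_normal_distribution power_mult_distrib)
  finally show ?thesis .
qed

lemma real_distribution_centered_normal:
  assumes "0 < v"
  shows "real_distribution (centered_normal v)"
  unfolding real_distribution_def real_distribution_axioms_def centered_normal_def
  using assms by (auto intro: prob_space_normal_density)

section \<open>Curie--Weiss averages\<close>

definition spin_mean :: "nat \<Rightarrow> ((nat \<Rightarrow> real) \<Rightarrow> real) \<Rightarrow> real" where
  "spin_mean N f = (\<Sum>\<sigma>\<in>spin_configs N. f \<sigma>) / 2 ^ N"

definition magnetization :: "nat \<Rightarrow> (nat \<Rightarrow> real) \<Rightarrow> real" where
  "magnetization N \<sigma> = (\<Sum>i=1..N. \<sigma> i)"

lemma finite_spin_configs [simp]: "finite (spin_configs N)"
  by (auto simp: spin_configs_def intro!: finite_PiE)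

lemma card_spin_configs: "card (spin_configs N) = 2 ^ N"
  by (simp add: spin_configs_def card_PiE numeral_2_eq_2)

lemma spin_configs_cases:
  assumes "\<sigma> \<in> spin_configs N" "i \<in> {1..N}"
  shows "\<sigma> i = -1 \<or> \<sigma> i = 1"
  using assms by (auto simp: spin_configs_def PiE_def Pi_def)

lemma spin_mean_exp_magnetization:
  "spin_mean N (\<lambda>\<sigma>. exp (u * magnetization N \<sigma>)) = cosh u ^ N"
proof -
  have "(\<Sum>\<sigma>\<in>spin_configs N. exp (u * magnetization N \<sigma>))
      = (\<Sum>\<sigma>\<in>{1..N} \<rightarrow>\<^sub>E {-1, 1::real}. \<Prod>i\<in>{1..N}. exp (u * \<sigma> i))"
    by (simp add: spin_configs_def magnetization_def sum_distrib_left exp_sum)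
  also have "\<dots> = (\<Prod>i\<in>{1..N}. \<Sum>s\<in>{-1, 1::real}. exp (u * s))"
    by (intro prod_sum_PiE[symmetric]) auto
  also have "\<dots> = (2 * cosh u) ^ N"
    by (simp add: cosh_field_def add.commute add_divide_distrib)
  finally show ?thesis
    by (simp add: spin_mean_def power_mult_distrib)
qed

text \<open>The Hubbard--Stratonovich transform linearises the square and reduces the claim to dominated
  convergence of \<^term>\<open>cosh (sqrt (2 * b n / n) * x) ^ n\<close> under the Gaussian.\<close>

lemma spin_mean_exp_quadratic_tendsto:
  fixes b :: "nat \<Rightarrow> real"
  assumes b_nonneg: "\<And>n. n > 0 \<Longrightarrow> 0 \<le> b n" and b_lim: "b \<longlonglongrightarrow> l" and l: "l < 1/2"
  shows "(\<lambda>n. spin_mean n (\<lambda>\<sigma>. exp (b n / real n * (magnetization n \<sigma>)\<^sup>2)))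
           \<longlonglongrightarrow> 1 / sqrt (1 - 2 * l)"
proof -
  have b_div_nonneg: "0 \<le> b n / real n" for n
    using b_nonneg[of n] by (cases "n = 0") auto
  define f where "f n x = std_normal_density x * cosh (sqrt (2 * b n / n) * x) ^ n" for n :: nat and x
  have hs: "spin_mean n (\<lambda>\<sigma>. exp (b n / real n * (magnetization n \<sigma>)\<^sup>2)) = (\<integral>x. f n x \<partial>lborel)" for n
  proof -
    let ?c = "sqrt (2 * b n / n)"
    have c: "?c\<^sup>2 / 2 = b n / n"
      using b_div_nonneg[of n] by simp
    have "has_bochner_integral lborel
        (\<lambda>x. (\<Sum>\<sigma>\<in>spin_configs n. std_normal_density x * exp (?c * magnetization n \<sigma> * x)) / 2 ^ n)
        ((\<Sum>\<sigma>\<in>spin_configs n. exp ((?c * magnetization n \<sigma>)\<^sup>2 / 2)) / 2 ^ n)"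
      by (intro has_bochner_integral_divide_zero has_bochner_integral_sum std_normal_exp_linear)
    also have "(\<lambda>x. (\<Sum>\<sigma>\<in>spin_configs n. std_normal_density x * exp (?c * magnetization n \<sigma> * x)) / 2 ^ n) = f n"
      using spin_mean_exp_magnetization[of n "?c * x" for x]
      by (simp add: f_def fun_eq_iff spin_mean_def sum_distrib_left[symmetric] mult_ac del: times_divide_eq_right
           add: times_divide_eq_right[symmetric])
    also have "(\<Sum>\<sigma>\<in>spin_configs n. exp ((?c * magnetization n \<sigma>)\<^sup>2 / 2)) / 2 ^ n
        = spin_mean n (\<lambda>\<sigma>. exp (b n / real n * (magnetization n \<sigma>)\<^sup>2))"
      using c by (simp add: spin_mean_def power_mult_distrib)
    finally show ?thesis
      by (simp add: has_bochner_integral_iff)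
  qed
  \<comment> \<open>A rate strictly between \<open>l\<close> and \<open>1/2\<close> eventually
    dominates \<open>b n\<close> and still leaves an integrable majorant.\<close>
  obtain B where B: "l < B" "B < 1/2"
    using l dense by blast
  \<comment> \<open>Nonnegativity of the rate serves index 0, where the power equals 1.\<close>
  define B' where "B' = max B 0"
  have B': "l < B'" "B' < 1/2" "0 \<le> B'"
    using B by (auto simp: B'_def)
  obtain n0 where n0: "\<And>n. n \<ge> n0 \<Longrightarrow> b n < B'"
    using order_tendstoD(2)[OF b_lim B'(1)] by (auto simp: eventually_sequentially)
  \<comment> \<open>Shifting by \<open>n0\<close> makes the domination hold at every index;
    \<open>LIMSEQ_offset\<close> undoes the shift at the end.\<close>
  have "(\<lambda>n. \<integral>x. f (n + n0) x \<partial>lborel) \<longlonglongrightarrow> (\<integral>x. std_normal_density x * exp (l * x\<^sup>2) \<partial>lborel)"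
  proof (rule integral_dominated_convergence[where w="\<lambda>x. std_normal_density x * exp (B' * x\<^sup>2)"])
    show "integrable lborel (\<lambda>x. std_normal_density x * exp (B' * x\<^sup>2))"
      using std_normal_exp_quadratic[OF B'(2)] by (simp add: has_bochner_integral_iff)
    show "AE x in lborel. (\<lambda>n. f (n + n0) x) \<longlonglongrightarrow> std_normal_density x * exp (l * x\<^sup>2)"
    proof (intro AE_I2 LIMSEQ_ignore_initial_segment)
      fix x
      have "(\<lambda>n. cosh (sqrt (2 * b n / n) * x) ^ n) \<longlonglongrightarrow> exp (l * x\<^sup>2)"
      proof -
        \<comment> \<open>The quotient is filled in at 0 because its argument vanishes when
          \<open>b n = 0\<close> or \<open>x = 0\<close>, so a limit along the full neighbourhood
          filter is wanted.\<close>
        have h: "((\<lambda>y. if y = 0 then 1/2 else (cosh y - 1) / y\<^sup>2) \<longlongrightarrow> (1/2::real)) (nhds 0)"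
        proof -
          have "((\<lambda>y::real. (cosh y - 1) / y\<^sup>2) \<longlongrightarrow> 1/2) (at 0)"
            by real_asymp
          then have "((\<lambda>y. if y = 0 then 1/2 else (cosh y - 1) / y\<^sup>2) \<longlongrightarrow> (1/2::real)) (at 0)"
            by (rule Lim_transform_eventually) (auto simp: eventually_at_filter)
          then show ?thesis
            by (simp add: tendsto_nhds_iff)
        qed
        let ?y = "\<lambda>n. sqrt (2 * b n / n) * x"
        have bn: "(\<lambda>n. b n * (1 / real n)) \<longlonglongrightarrow> l * 0"
          by (intro tendsto_mult b_lim lim_1_over_n)
        have "?y \<longlonglongrightarrow> sqrt (2 * 0) * x"
          using bn by (intro tendsto_mult tendsto_const tendsto_real_sqrt)
            (auto simp: divide_inverse mult.assoc intro!: tendsto_mult_right_zero)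
        then have y0: "?y \<longlonglongrightarrow> 0" by simp
        have eq: "real n * (cosh (?y n) - 1) =
            2 * b n * x\<^sup>2 * (if ?y n = 0 then 1/2 else (cosh (?y n) - 1) / (?y n)\<^sup>2)" if "n > 0" for n
        proof (cases "?y n = 0")
          case True
          then show ?thesis using that by auto
        next
          case False
          have "(?y n)\<^sup>2 = 2 * b n * x\<^sup>2 / n"
            using b_div_nonneg[of n] by (simp add: power_mult_distrib)
          then have "real n * (?y n)\<^sup>2 = 2 * b n * x\<^sup>2"
            using that by simp
          then have "2 * b n * x\<^sup>2 * ((cosh (?y n) - 1) / (?y n)\<^sup>2)
              = real n * (?y n)\<^sup>2 * ((cosh (?y n) - 1) / (?y n)\<^sup>2)"
            by (simp only:)
          also have "\<dots> = real n * (cosh (?y n) - 1)"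
            using False by (simp del: mult_eq_0_iff)
          finally show ?thesis
            using False by (simp only: if_False)
        qed
        have "(\<lambda>n. 2 * b n * x\<^sup>2 * (if ?y n = 0 then 1/2 else (cosh (?y n) - 1) / (?y n)\<^sup>2))
            \<longlonglongrightarrow> 2 * l * x\<^sup>2 * (1/2)" (is "?g \<longlonglongrightarrow> _")
          by (intro tendsto_mult tendsto_const b_lim filterlim_compose[OF h y0])
        then have "?g \<longlonglongrightarrow> l * x\<^sup>2"
          by simp
        moreover have "\<forall>\<^sub>F n in sequentially. ?g n = real n * (cosh (?y n) - 1)"
          using eventually_gt_at_top[of 0] by eventually_elim (rule eq[symmetric])
        ultimately have "(\<lambda>n. real n * (cosh (?y n) - 1)) \<longlonglongrightarrow> l * x\<^sup>2"
          by (rule Lim_transform_eventually)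
        moreover have "(\<lambda>n. cosh (?y n) - 1) \<longlonglongrightarrow> cosh 0 - 1"
          by (intro tendsto_intros y0)
        ultimately show ?thesis
          using tendsto_one_plus_power_exp[of "\<lambda>n. cosh (?y n) - 1" "\<lambda>n. n"] by simp
      qed
      then show "(\<lambda>n. f n x) \<longlonglongrightarrow> std_normal_density x * exp (l * x\<^sup>2)"
        unfolding f_def by (intro tendsto_mult tendsto_const)
    qed
    show "AE x in lborel. norm (f (n + n0) x) \<le> std_normal_density x * exp (B' * x\<^sup>2)" for n
    proof (intro AE_I2)
      fix x
      define m where "m = n + n0"
      have "cosh (sqrt (2 * b m / m) * x) ^ m \<le> exp ((sqrt (2 * b m / m) * x)\<^sup>2 / 2) ^ m"
        by (intro power_mono cosh_le_exp_half_square) simp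
      also have "(sqrt (2 * b m / m) * x)\<^sup>2 / 2 = b m / m * x\<^sup>2"
        using b_div_nonneg[of m] by (simp add: power_mult_distrib)
      also have "exp (b m / m * x\<^sup>2) ^ m = exp (real m * (b m / m * x\<^sup>2))"
        by (simp only: exp_of_nat_mult)
      also have "\<dots> \<le> exp (B' * x\<^sup>2)"
      proof (cases "m = 0")
        case False
        have "b m * x\<^sup>2 \<le> B' * x\<^sup>2"
          using n0[of m] by (intro mult_right_mono) (auto simp: m_def)
        with False show ?thesis by simp
      qed (use B' in simp)
      finally have "norm (f m x) \<le> std_normal_density x * exp (B' * x\<^sup>2)"
        unfolding f_def by (simp add: abs_mult mult_left_mono)
      then show "norm (f (n + n0) x) \<le> std_normal_density x * exp (B' * x\<^sup>2)"
        by (simp add: m_def)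
    qed
    show "(\<lambda>x. f (n + n0) x) \<in> borel_measurable lborel" for n
      unfolding f_def cosh_field_def by measurable
  qed measurable
  also have "(\<integral>x. std_normal_density x * exp (l * x\<^sup>2) \<partial>lborel) = 1 / sqrt (1 - 2 * l)"
    using std_normal_exp_quadratic[OF l] by (simp add: has_bochner_integral_iff)
  finally show ?thesis
    unfolding hs by (rule LIMSEQ_offset)
qed

section \<open>Products over edges and the overlap of two replicas\<close>

abbreviation edges :: "nat \<Rightarrow> (nat \<times> nat) set" where
  "edges N \<equiv> {1..N} \<times> {1..N}"

text \<open>A positive function of a sign has the form \<open>s * exp (\<alpha> * x)\<close>: two
  values fix two constants. The product of \<open>1 + a\<close> and \<open>1 - a\<close> is
  \<open>s\<^sup>2\<close>, and their quotient is \<open>exp (2 * artanh a)\<close>.\<close>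

lemma one_plus_spin_eq_exp:
  fixes a x :: real
  assumes "\<bar>a\<bar> < 1" "x = -1 \<or> x = 1"
  shows "1 + a * x = sqrt (1 - a\<^sup>2) * exp (artanh a * x)"
proof -
  have pos: "0 < 1 + a" "0 < 1 - a" using assms by auto
  have "(1 - a\<^sup>2) = (1 + a) * (1 - a)"
    by (simp add: power2_eq_square algebra_simps)
  then have s: "sqrt (1 - a\<^sup>2) = exp ((ln (1 + a) + ln (1 - a)) / 2)"
    using pos by (simp add: powr_half_sqrt[symmetric] powr_def ln_mult)
  have "artanh a = (ln (1 + a) - ln (1 - a)) / 2"
    using pos by (simp add: artanh_def ln_div)
  then have "sqrt (1 - a\<^sup>2) * exp (artanh a * x)
      = exp ((ln (1 + a) + ln (1 - a)) / 2 + (ln (1 + a) - ln (1 - a)) / 2 * x)"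
    unfolding s by (simp add: exp_add)
  also have "\<dots> = 1 + a * x"
    using assms(2) pos by (auto simp: add_divide_distrib[symmetric])
  finally show ?thesis ..
qed

lemma spin_configs_mult_cases:
  assumes "\<sigma> \<in> spin_configs N" "z \<in> edges N"
  shows "\<sigma> (fst z) * \<sigma> (snd z) = -1 \<or> \<sigma> (fst z) * \<sigma> (snd z) = 1"
  using spin_configs_cases[OF assms(1), of "fst z"] spin_configs_cases[OF assms(1), of "snd z"] assms(2)
  by auto

text \<open>Loops and both orientations of every pair are edges, so a full square appears without
  diagonal correction and the averages are exactly of Curie--Weiss type.\<close>

lemma sum_spin_pairs:
  "(\<Sum>z\<in>edges N. \<sigma> (fst z) * \<sigma> (snd z)) = (magnetization N \<sigma>)\<^sup>2"
  by (simp add: magnetization_def power2_eq_square sum_product sum.cartesian_product split_def)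

lemma prod_one_plus_spin_pairs:
  assumes "\<bar>a\<bar> < 1" "\<sigma> \<in> spin_configs N"
  shows "(\<Prod>z\<in>edges N. 1 + a * (\<sigma> (fst z) * \<sigma> (snd z)))
       = sqrt ((1 - a\<^sup>2) ^ N\<^sup>2) * exp (artanh a * (magnetization N \<sigma>)\<^sup>2)"
proof -
  have "(\<Prod>z\<in>edges N. 1 + a * (\<sigma> (fst z) * \<sigma> (snd z)))
      = (\<Prod>z\<in>edges N. sqrt (1 - a\<^sup>2) * exp (artanh a * (\<sigma> (fst z) * \<sigma> (snd z))))"
    using assms by (intro prod.cong refl one_plus_spin_eq_exp spin_configs_mult_cases)
  also have "\<dots> = sqrt (1 - a\<^sup>2) ^ N\<^sup>2 * exp (artanh a * (\<Sum>z\<in>edges N. \<sigma> (fst z) * \<sigma> (snd z)))"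
    by (simp add: prod.distrib exp_sum sum_distrib_left power2_eq_square)
  finally show ?thesis
    unfolding sum_spin_pairs real_sqrt_power .
qed

text \<open>The factor \<^term>\<open>1 + a * (x + y) + d * (x * y)\<close> differs from \<^term>\<open>(1 + a * x) * (1 + a * y)\<close>
  by \<^term>\<open>(d - a\<^sup>2) * (x * y)\<close>, and the relative error is again affine in \<open>x\<close>, \<open>y\<close> and \<open>x * y\<close>
  because \<^term>\<open>1 / (1 + a * x) = (1 - a * x) / (1 - a\<^sup>2)\<close> for a sign \<open>x\<close>.\<close>

lemma overlap_factor_le_exp:
  fixes a d x y :: real
  assumes a: "\<bar>a\<bar> < 1" and x: "x = -1 \<or> x = 1" and y: "y = -1 \<or> y = 1"
  defines "e \<equiv> (d - a\<^sup>2) / (1 - a\<^sup>2)\<^sup>2"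
  shows "1 + a * (x + y) + d * (x * y)
       \<le> (1 - a\<^sup>2) * exp ((artanh a - e * a) * (x + y) + e * (x * y) + e * a\<^sup>2)"
proof -
  define r where "r = e * (x * y - a * (x + y) + a\<^sup>2)"
  have pos: "0 < 1 + a * x" "0 < 1 + a * y"
    using a x y by auto
  have nz: "1 - a\<^sup>2 \<noteq> 0"
    using a by (simp add: abs_square_eq_1)
  \<comment> \<open>The last bracket is \<open>(x - a) * (y - a)\<close>, and
    \<open>(1 + a * x) * (x - a) = x * (1 - a\<^sup>2)\<close> for a sign \<open>x\<close>.\<close>
  have "(1 + a * x) * (1 + a * y) * (x * y - a * (x + y) + a\<^sup>2) = x * y * (1 - a\<^sup>2)\<^sup>2"
    using x y by (auto simp: power2_eq_square algebra_simps)
  then have "(1 + a * x) * (1 + a * y) * r = (d - a\<^sup>2) * (x * y)"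
  proof -
    assume *: "(1 + a * x) * (1 + a * y) * (x * y - a * (x + y) + a\<^sup>2) = x * y * (1 - a\<^sup>2)\<^sup>2"
    have "(1 + a * x) * (1 + a * y) * r
        = e * ((1 + a * x) * (1 + a * y) * (x * y - a * (x + y) + a\<^sup>2))"
      by (simp add: r_def mult_ac)
    also have "\<dots> = (d - a\<^sup>2) * (x * y)"
      unfolding * using nz by (simp add: e_def)
    finally show ?thesis .
  qed
  moreover have "(1 + a * x) * (1 + a * y) = 1 + a * (x + y) + a\<^sup>2 * (x * y)"
    by (simp add: algebra_simps power2_eq_square)
  ultimately have "1 + a * (x + y) + d * (x * y) = (1 + a * x) * (1 + a * y) * (1 + r)"
    by (simp only: distrib_left left_diff_distrib) simp
  \<comment> \<open>Passing to \<open>exp r\<close> lets the product over edges become the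
    exponential of a sum of pair interactions.\<close>
  also have "\<dots> \<le> (1 + a * x) * (1 + a * y) * exp r"
    using pos by (intro mult_left_mono exp_ge_add_one_self) auto
  also have "(1 + a * x) * (1 + a * y) = (1 - a\<^sup>2) * exp (artanh a * (x + y))"
  proof -
    have "0 \<le> 1 - a\<^sup>2" using a by (simp add: abs_square_le_1)
    then show ?thesis
      unfolding one_plus_spin_eq_exp[OF a x] one_plus_spin_eq_exp[OF a y]
      by (simp add: algebra_simps exp_add)
  qed
  also have "(1 - a\<^sup>2) * exp (artanh a * (x + y)) * exp r
      = (1 - a\<^sup>2) * exp ((artanh a - e * a) * (x + y) + e * (x * y) + e * a\<^sup>2)"
    by (simp add: exp_add[symmetric] r_def algebra_simps)
  finally show ?thesis .
qed

lemma sum_spin_pairs_mult: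
  "(\<Sum>z\<in>edges N. (\<sigma> (fst z) * \<sigma> (snd z)) * (\<tau> (fst z) * \<tau> (snd z)))
     = (magnetization N (\<lambda>i. \<sigma> i * \<tau> i))\<^sup>2"
  by (subst sum_spin_pairs[symmetric]) (simp add: mult_ac)

text \<open>Multiplying the bounds on the factors leaves one quadratic energy per replica and one
  for the overlap, the latter with coupling \<open>e\<close>. The correction \<open>- e * a\<close>
  to the single-replica coupling is nonpositive and is dropped.\<close>

lemma prod_overlap_factor_le:
  assumes a: "0 \<le> a" "a < 1" and d: "a\<^sup>2 \<le> d" "d \<le> 1"
    and \<sigma>: "\<sigma> \<in> spin_configs N" and \<tau>: "\<tau> \<in> spin_configs N"
  defines "e \<equiv> (d - a\<^sup>2) / (1 - a\<^sup>2)\<^sup>2"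
  shows "(\<Prod>z\<in>edges N. 1 + a * (\<sigma> (fst z) * \<sigma> (snd z) + \<tau> (fst z) * \<tau> (snd z))
             + d * ((\<sigma> (fst z) * \<sigma> (snd z)) * (\<tau> (fst z) * \<tau> (snd z))))
       \<le> (1 - a\<^sup>2) ^ N\<^sup>2 * exp (e * a\<^sup>2 * (real N)\<^sup>2)
          * (exp (artanh a * ((magnetization N \<sigma>)\<^sup>2 + (magnetization N \<tau>)\<^sup>2))
             * exp (e * (magnetization N (\<lambda>i. \<sigma> i * \<tau> i))\<^sup>2))"
proof -
  let ?E = "edges N"
  define x where "x z = \<sigma> (fst z) * \<sigma> (snd z)" for z
  define y where "y z = \<tau> (fst z) * \<tau> (snd z)" for z
  have x: "x z = -1 \<or> x z = 1" if "z \<in> ?E" for z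
    using spin_configs_mult_cases[OF \<sigma> that] by (simp add: x_def)
  have y: "y z = -1 \<or> y z = 1" if "z \<in> ?E" for z
    using spin_configs_mult_cases[OF \<tau> that] by (simp add: y_def)
  have e: "0 \<le> e" using d by (simp add: e_def)
  \<comment> \<open>Bounds may be multiplied only for nonnegative factors. Among equal signs the
    worst case is \<open>x = y = -1\<close>, with value
    \<open>(1 - a)\<^sup>2 + (d - a\<^sup>2)\<close>; opposite signs give
    \<open>1 - d\<close>.\<close>
  have nonneg: "0 \<le> 1 + a * (x z + y z) + d * (x z * y z)" if "z \<in> ?E" for z
  proof -
    have "0 \<le> (1 - a)\<^sup>2 + (d - a\<^sup>2)" using d by simp
    then have "0 \<le> 1 - 2 * a + d" by (simp add: power2_eq_square algebra_simps)
    moreover have "0 \<le> d" using d(1) by (rule order_trans[rotated]) simp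
    ultimately show ?thesis
      using x[OF that] y[OF that] a d by auto
  qed
  have "(\<Prod>z\<in>?E. 1 + a * (x z + y z) + d * (x z * y z))
      \<le> (\<Prod>z\<in>?E. (1 - a\<^sup>2) * exp ((artanh a - e * a) * (x z + y z) + e * (x z * y z) + e * a\<^sup>2))"
    unfolding e_def using a x y
    by (intro prod_mono conjI nonneg overlap_factor_le_exp) auto
  also have "\<dots> = (1 - a\<^sup>2) ^ N\<^sup>2 * exp (\<Sum>z\<in>?E. (artanh a - e * a) * (x z + y z) + e * (x z * y z) + e * a\<^sup>2)"
    by (simp add: prod.distrib exp_sum power2_eq_square)
  also have "(\<Sum>z\<in>?E. (artanh a - e * a) * (x z + y z) + e * (x z * y z) + e * a\<^sup>2)
      = (artanh a - e * a) * ((\<Sum>z\<in>?E. x z) + (\<Sum>z\<in>?E. y z)) + e * (\<Sum>z\<in>?E. x z * y z) + e * a\<^sup>2 * (real N)\<^sup>2"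
    by (simp add: sum.distrib sum_distrib_left power2_eq_square distrib_left)
  also have "\<dots> = (artanh a - e * a) * ((magnetization N \<sigma>)\<^sup>2 + (magnetization N \<tau>)\<^sup>2)
      + e * (magnetization N (\<lambda>i. \<sigma> i * \<tau> i))\<^sup>2 + e * a\<^sup>2 * (real N)\<^sup>2"
    unfolding x_def y_def sum_spin_pairs sum_spin_pairs_mult ..
  also have "(1 - a\<^sup>2) ^ N\<^sup>2 * exp \<dots> \<le> (1 - a\<^sup>2) ^ N\<^sup>2 * exp (e * a\<^sup>2 * (real N)\<^sup>2
     + artanh a * ((magnetization N \<sigma>)\<^sup>2 + (magnetization N \<tau>)\<^sup>2)
     + e * (magnetization N (\<lambda>i. \<sigma> i * \<tau> i))\<^sup>2)"
  proof -
    have "0 \<le> 1 - a\<^sup>2" using a by (simp add: abs_square_le_1)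
    moreover have "0 \<le> e * a * ((magnetization N \<sigma>)\<^sup>2 + (magnetization N \<tau>)\<^sup>2)"
      using a e by simp
    ultimately show ?thesis
      by (intro mult_left_mono) (auto simp: left_diff_distrib)
  qed
  finally show ?thesis
    by (simp add: x_def y_def exp_add mult_ac)
qed

lemma spin_mean_mono:
  assumes "\<And>\<sigma>. \<sigma> \<in> spin_configs N \<Longrightarrow> f \<sigma> \<le> g \<sigma>"
  shows "spin_mean N f \<le> spin_mean N g"
  unfolding spin_mean_def using assms by (intro divide_right_mono sum_mono) auto

lemma spin_mean_cong:
  assumes "\<And>\<sigma>. \<sigma> \<in> spin_configs N \<Longrightarrow> f \<sigma> = g \<sigma>"
  shows "spin_mean N f = spin_mean N g"
  unfolding spin_mean_def using assms by simp

lemma spin_mean_add: "spin_mean N (\<lambda>\<sigma>. f \<sigma> + g \<sigma>) = spin_mean N f + spin_mean N g"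
  by (simp add: spin_mean_def sum.distrib add_divide_distrib)

lemma spin_mean_cmult: "spin_mean N (\<lambda>\<sigma>. c * f \<sigma>) = c * spin_mean N f"
  by (simp add: spin_mean_def sum_distrib_left)

lemma spin_mean_cmult_right: "spin_mean N (\<lambda>\<sigma>. f \<sigma> * c) = spin_mean N f * c"
  by (simp add: spin_mean_def sum_distrib_right)

lemma spin_mean_const: "spin_mean N (\<lambda>\<sigma>. c) = c"
  by (simp add: spin_mean_def card_spin_configs)

text \<open>Spinwise multiplication by the fixed \<open>\<sigma>\<close> is an involution of the
  configurations, so the overlap with \<open>\<sigma>\<close> is distributed like the magnetization.
  The \<open>restrict\<close> keeps the image extensional outside \<open>{1..N}\<close>.\<close>

lemma spin_mean_gauge:
  assumes "\<sigma> \<in> spin_configs N"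
  shows "spin_mean N (\<lambda>\<tau>. f (magnetization N (\<lambda>i. \<sigma> i * \<tau> i))) = spin_mean N (\<lambda>\<tau>. f (magnetization N \<tau>))"
proof -
  let ?g = "\<lambda>\<tau>. restrict (\<lambda>i. \<sigma> i * \<tau> i) {1..N}"
  have mem: "?g \<tau> \<in> spin_configs N" if "\<tau> \<in> spin_configs N" for \<tau>
    using spin_configs_cases[OF assms] spin_configs_cases[OF that]
    unfolding spin_configs_def by (intro PiE_I) fastforce+
  have inv: "?g (?g \<tau>) = \<tau>" if "\<tau> \<in> spin_configs N" for \<tau>
  proof
    fix i
    show "?g (?g \<tau>) i = \<tau> i"
    proof (cases "i \<in> {1..N}")
      case True
      then show ?thesis using spin_configs_cases[OF assms True] by auto
    next
      case False
      then show ?thesis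
        using PiE_arb[OF that[unfolded spin_configs_def] False] by (simp only: restrict_apply if_False)
    qed
  qed
  have mag: "magnetization N (?g \<tau>) = magnetization N (\<lambda>i. \<sigma> i * \<tau> i)" for \<tau>
    unfolding magnetization_def by (intro sum.cong refl) simp
  have "(\<Sum>\<tau>\<in>spin_configs N. f (magnetization N (\<lambda>i. \<sigma> i * \<tau> i)))
      = (\<Sum>\<tau>\<in>spin_configs N. f (magnetization N \<tau>))"
    by (rule sum.reindex_bij_witness[where i="?g" and j="?g"]; (rule mem inv arg_cong[OF mag])?; assumption?)
  then show ?thesis by (simp add: spin_mean_def)
qed

text \<open>Young's inequality decouples the overlap from the two magnetizations.\<close>

lemma spin_mean_overlap_le:
  assumes q: "1 < q"
  shows "spin_mean N (\<lambda>\<sigma>. spin_mean N (\<lambda>\<tau>. exp (\<alpha> * ((magnetization N \<sigma>)\<^sup>2 + (magnetization N \<tau>)\<^sup>2))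
             * exp (e * (magnetization N (\<lambda>i. \<sigma> i * \<tau> i))\<^sup>2)))
       \<le> (1/q) * (spin_mean N (\<lambda>\<sigma>. exp (q * \<alpha> * (magnetization N \<sigma>)\<^sup>2)))\<^sup>2
          + (1 - 1/q) * spin_mean N (\<lambda>\<sigma>. exp (q / (q - 1) * e * (magnetization N \<sigma>)\<^sup>2))"
proof -
  \<comment> \<open>Convexity of \<open>exp\<close> between \<open>q * u\<close> and
    \<open>q / (q - 1) * v\<close> with weights \<open>1/q\<close> and \<open>1 - 1/q\<close>, whose
    weighted mean is \<open>u + v\<close>.\<close>
  have young: "exp u * exp v \<le> (1/q) * exp (q * u) + (1 - 1/q) * exp (q / (q - 1) * v)" for u v :: real
  proof -
    have "exp ((1 - (1 - 1/q)) *\<^sub>R (q * u) + (1 - 1/q) *\<^sub>R (q / (q - 1) * v))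
        \<le> (1 - (1 - 1/q)) * exp (q * u) + (1 - 1/q) * exp (q / (q - 1) * v)"
      using q by (intro convex_onD[OF exp_convex]) auto
    also have "(1 - (1 - 1/q)) *\<^sub>R (q * u) + (1 - 1/q) *\<^sub>R (q / (q - 1) * v) = u + v"
      using q by (simp add: field_simps)
    finally show ?thesis by (simp add: exp_add)
  qed
  let ?m = "magnetization N"
  have "spin_mean N (\<lambda>\<sigma>. spin_mean N (\<lambda>\<tau>. exp (\<alpha> * ((?m \<sigma>)\<^sup>2 + (?m \<tau>)\<^sup>2)) * exp (e * (?m (\<lambda>i. \<sigma> i * \<tau> i))\<^sup>2)))
     \<le> spin_mean N (\<lambda>\<sigma>. spin_mean N (\<lambda>\<tau>. (1/q) * exp (q * (\<alpha> * ((?m \<sigma>)\<^sup>2 + (?m \<tau>)\<^sup>2)))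
           + (1 - 1/q) * exp (q / (q - 1) * (e * (?m (\<lambda>i. \<sigma> i * \<tau> i))\<^sup>2))))"
    by (intro spin_mean_mono young)
  also have "\<dots> = spin_mean N (\<lambda>\<sigma>. (1/q) * spin_mean N (\<lambda>\<tau>. exp (q * (\<alpha> * ((?m \<sigma>)\<^sup>2 + (?m \<tau>)\<^sup>2))))
           + (1 - 1/q) * spin_mean N (\<lambda>\<tau>. exp (q / (q - 1) * (e * (?m \<tau>)\<^sup>2))))"
    unfolding spin_mean_add spin_mean_cmult
    by (intro spin_mean_cong arg_cong2[where f="(+)"] arg_cong2[where f="(*)"] refl spin_mean_gauge)
  \<comment> \<open>With the overlap split off, the two replicas are independent; this produces the
    square.\<close>
  also have "\<dots> = spin_mean N (\<lambda>\<sigma>. (1/q) * (exp (q * \<alpha> * (?m \<sigma>)\<^sup>2) * spin_mean N (\<lambda>\<tau>. exp (q * \<alpha> * (?m \<tau>)\<^sup>2)))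
           + (1 - 1/q) * spin_mean N (\<lambda>\<tau>. exp (q / (q - 1) * (e * (?m \<tau>)\<^sup>2))))"
    unfolding spin_mean_cmult[symmetric] by (simp add: exp_add[symmetric] algebra_simps)
  also have "\<dots> = (1/q) * (spin_mean N (\<lambda>\<sigma>. exp (q * \<alpha> * (?m \<sigma>)\<^sup>2)))\<^sup>2
          + (1 - 1/q) * spin_mean N (\<lambda>\<sigma>. exp (q / (q - 1) * e * (?m \<sigma>)\<^sup>2))"
    unfolding spin_mean_add spin_mean_cmult spin_mean_cmult_right spin_mean_const
    by (simp add: power2_eq_square mult.assoc)
  finally show ?thesis .
qed

definition spin_pair_mean :: "nat \<Rightarrow> real \<Rightarrow> real" where
  "spin_pair_mean N a = spin_mean N (\<lambda>\<sigma>. \<Prod>z\<in>edges N. 1 + a * (\<sigma> (fst z) * \<sigma> (snd z)))"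

text \<open>An edge weight \<open>t * \<epsilon>\<close> has mean \<open>a = p * t\<close> and
  second moment \<open>d = p * t\<^sup>2\<close>, which enters because both replicas see the same
  edges. For \<open>d = a\<^sup>2\<close> the replicas would decouple.\<close>

definition spin_pair_overlap_mean :: "nat \<Rightarrow> real \<Rightarrow> real \<Rightarrow> real" where
  "spin_pair_overlap_mean N a d = spin_mean N (\<lambda>\<sigma>. spin_mean N (\<lambda>\<tau>. \<Prod>z\<in>edges N.
     1 + a * (\<sigma> (fst z) * \<sigma> (snd z) + \<tau> (fst z) * \<tau> (snd z))
       + d * ((\<sigma> (fst z) * \<sigma> (snd z)) * (\<tau> (fst z) * \<tau> (snd z)))))"

section \<open>Limits of the one-replica and two-replica averages\<close>

context
  fixes a d :: "nat \<Rightarrow> real" and l :: real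
  assumes a_range: "\<And>n. n > 0 \<Longrightarrow> 0 \<le> a n \<and> a n < 1"
    and a_lim: "(\<lambda>n. real n * a n) \<longlonglongrightarrow> l"
    and l: "l < 1/2"
begin

lemma seq_tendsto_0: "a \<longlonglongrightarrow> 0"
proof (rule Lim_transform_eventually)
  have "(\<lambda>n. real n * a n * (1 / real n)) \<longlonglongrightarrow> l * 0"
    by (intro tendsto_mult a_lim lim_1_over_n)
  then show "(\<lambda>n. real n * a n * (1 / real n)) \<longlonglongrightarrow> 0"
    by simp
  show "\<forall>\<^sub>F n in sequentially. real n * a n * (1 / real n) = a n"
    using eventually_gt_at_top[of 0] by eventually_elim simp
qed

lemma artanh_seq_nonneg: "0 \<le> artanh (a n)" if "n > 0"
  using a_range[OF that] by (simp add: artanh_def)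

lemma n_artanh_tendsto: "(\<lambda>n. real n * artanh (a n)) \<longlonglongrightarrow> l"
proof (rule Lim_transform_eventually)
  have "(\<lambda>n. real n * ln (1 + a n)) \<longlonglongrightarrow> l"
    by (intro tendsto_mult_ln_one_plus seq_tendsto_0 a_lim)
  moreover have "(\<lambda>n. real n * ln (1 + (- a n))) \<longlonglongrightarrow> - l"
    using tendsto_minus[OF seq_tendsto_0] tendsto_minus[OF a_lim]
    by (intro tendsto_mult_ln_one_plus) auto
  ultimately have "(\<lambda>n. (real n * ln (1 + a n) - real n * ln (1 + (- a n))) / 2) \<longlonglongrightarrow> (l - (- l)) / 2"
    by (intro tendsto_intros) auto
  then show "(\<lambda>n. (real n * ln (1 + a n) - real n * ln (1 + (- a n))) / 2) \<longlonglongrightarrow> l"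
    by simp
  show "\<forall>\<^sub>F n in sequentially. (real n * ln (1 + a n) - real n * ln (1 + (- a n))) / 2 = real n * artanh (a n)"
    using eventually_gt_at_top[of 0]
  proof eventually_elim
    case (elim n)
    from a_range[OF elim] show ?case
      by (simp add: artanh_def ln_div right_diff_distrib)
  qed
qed

lemma one_minus_square_power_tendsto: "(\<lambda>n. (1 - (a n)\<^sup>2) ^ n\<^sup>2) \<longlonglongrightarrow> exp (- l\<^sup>2)"
proof -
  have "(\<lambda>n. - (a n)\<^sup>2) \<longlonglongrightarrow> - (0\<^sup>2)"
    by (intro tendsto_intros seq_tendsto_0)
  moreover have "(\<lambda>n. - (real n * a n)\<^sup>2) \<longlonglongrightarrow> - (l\<^sup>2)"
    by (intro tendsto_intros a_lim)
  ultimately show ?thesis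
    using tendsto_one_plus_power_exp[of "\<lambda>n. - (a n)\<^sup>2" "\<lambda>n. n\<^sup>2" "- l\<^sup>2"]
    by (simp add: power_mult_distrib)
qed

text \<open>The exponential is the limit of the normalisation \<open>sqrt (1 - a\<^sup>2)\<close>
  taken over \<open>n\<^sup>2\<close> edges; the other factor is the Curie--Weiss average with
  coupling \<open>n * artanh (a n)\<close>. At \<open>l = \<beta> / 2\<close> this is the limit of
  the mean of \<open>W\<close>.\<close>

lemma spin_pair_mean_tendsto:
  "(\<lambda>n. spin_pair_mean n (a n)) \<longlonglongrightarrow> exp (- l\<^sup>2 / 2) / sqrt (1 - 2 * l)"
proof (rule Lim_transform_eventually)
  let ?m = "\<lambda>n. spin_mean n (\<lambda>\<sigma>. exp (real n * artanh (a n) / real n * (magnetization n \<sigma>)\<^sup>2))"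
  have "(\<lambda>n. sqrt ((1 - (a n)\<^sup>2) ^ n\<^sup>2) * ?m n) \<longlonglongrightarrow> sqrt (exp (- l\<^sup>2)) * (1 / sqrt (1 - 2 * l))"
    by (intro tendsto_mult tendsto_real_sqrt one_minus_square_power_tendsto
          spin_mean_exp_quadratic_tendsto n_artanh_tendsto l mult_nonneg_nonneg artanh_seq_nonneg) auto
  also have "sqrt (exp (- l\<^sup>2)) = exp (- l\<^sup>2 / 2)"
    by (intro real_sqrt_unique) (auto simp: power2_eq_square exp_add[symmetric])
  finally show "(\<lambda>n. sqrt ((1 - (a n)\<^sup>2) ^ n\<^sup>2) * ?m n) \<longlonglongrightarrow> exp (- l\<^sup>2 / 2) / sqrt (1 - 2 * l)"
    by simp
  show "\<forall>\<^sub>F n in sequentially. sqrt ((1 - (a n)\<^sup>2) ^ n\<^sup>2) * ?m n = spin_pair_mean n (a n)"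
    using eventually_gt_at_top[of 0]
  proof eventually_elim
    case (elim n)
    have "\<bar>a n\<bar> < 1" using a_range[OF elim] by simp
    then show ?case
      unfolding spin_pair_mean_def spin_mean_cmult[symmetric] using elim
      by (intro spin_mean_cong) (simp add: prod_one_plus_spin_pairs del: One_nat_def)
  qed
qed

text \<open>The value below \<open>\<eta>\<close> is the square of the limit of
  \<open>spin_pair_mean\<close>, so the replicas are asymptotically uncorrelated. The Young exponent
  \<open>q > 1\<close> is fixed close to 1 before \<open>n\<close> grows.\<close>

lemma spin_pair_overlap_mean_upper:
  assumes d_range: "\<And>n. n > 0 \<Longrightarrow> (a n)\<^sup>2 \<le> d n \<and> d n \<le> 1"
    and d_lim: "(\<lambda>n. real n * d n) \<longlonglongrightarrow> 0"
    and \<eta>: "exp (- l\<^sup>2) / (1 - 2 * l) < \<eta>"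
  shows "\<forall>\<^sub>F n in sequentially. spin_pair_overlap_mean n (a n) (d n) < \<eta>"
proof -
  \<comment> \<open>For fixed \<open>q\<close>, \<open>h q\<close> is the limit of the bound
    \<open>U\<close> below; at \<open>q = 1\<close> it is the value assumed to lie below
    \<open>\<eta>\<close>.\<close>
  define h where "h q = exp (- l\<^sup>2) * (1 / q * (1 / (1 - 2 * (q * l))) + (1 - 1 / q))" for q :: real
  have "(h \<longlongrightarrow> h 1) (at_right 1)"
    unfolding h_def using l by (intro tendsto_intros) auto
  moreover have "h 1 < \<eta>"
    using \<eta> by (simp add: h_def)
  ultimately have "\<forall>\<^sub>F q in at_right 1. h q < \<eta>"
    by (rule order_tendstoD(2))
  \<comment> \<open>This keeps the enlarged coupling \<open>q * artanh (a n)\<close> in the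
    high-temperature regime.\<close>
  moreover have "\<forall>\<^sub>F q in at_right 1. q * l < 1/2"
    using l by (intro order_tendstoD(2)[where y="1 * l"] tendsto_intros) auto
  moreover have "\<forall>\<^sub>F q in at_right 1. (1::real) < q"
    by (simp add: eventually_at_right_less)
  ultimately have "\<forall>\<^sub>F q in at_right 1. h q < \<eta> \<and> q * l < 1/2 \<and> 1 < q"
    by eventually_elim simp
  then obtain q where q: "h q < \<eta>" "q * l < 1/2" "1 < q"
    using eventually_happens'[OF trivial_limit_at_right_real] by blast
  define e where "e n = (d n - (a n)\<^sup>2) / (1 - (a n)\<^sup>2)\<^sup>2" for n
  define U where "U n = (1 - (a n)\<^sup>2) ^ n\<^sup>2 * exp (e n * (a n)\<^sup>2 * (real n)\<^sup>2)
     * ((1/q) * (spin_mean n (\<lambda>\<sigma>. exp (q * artanh (a n) * (magnetization n \<sigma>)\<^sup>2)))\<^sup>2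
          + (1 - 1/q) * spin_mean n (\<lambda>\<sigma>. exp (q / (q - 1) * e n * (magnetization n \<sigma>)\<^sup>2)))" for n
  have le_U: "spin_pair_overlap_mean n (a n) (d n) \<le> U n" if "n > 0" for n
  proof -
    have nn: "0 \<le> (1 - (a n)\<^sup>2) ^ n\<^sup>2"
      using a_range[OF that] by (intro zero_le_power) (simp add: abs_square_le_1)
    have "spin_pair_overlap_mean n (a n) (d n) \<le> spin_mean n (\<lambda>\<sigma>. spin_mean n (\<lambda>\<tau>.
        (1 - (a n)\<^sup>2) ^ n\<^sup>2 * exp (e n * (a n)\<^sup>2 * (real n)\<^sup>2)
          * (exp (artanh (a n) * ((magnetization n \<sigma>)\<^sup>2 + (magnetization n \<tau>)\<^sup>2))
             * exp (e n * (magnetization n (\<lambda>i. \<sigma> i * \<tau> i))\<^sup>2))))"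
      unfolding spin_pair_overlap_mean_def e_def using a_range[OF that] d_range[OF that]
      by (intro spin_mean_mono prod_overlap_factor_le) auto
    also have "\<dots> = (1 - (a n)\<^sup>2) ^ n\<^sup>2 * exp (e n * (a n)\<^sup>2 * (real n)\<^sup>2) * spin_mean n (\<lambda>\<sigma>. spin_mean n (\<lambda>\<tau>.
          exp (artanh (a n) * ((magnetization n \<sigma>)\<^sup>2 + (magnetization n \<tau>)\<^sup>2))
             * exp (e n * (magnetization n (\<lambda>i. \<sigma> i * \<tau> i))\<^sup>2)))"
      unfolding spin_mean_cmult ..
    also have "\<dots> \<le> U n"
      unfolding U_def using nn by (intro mult_left_mono spin_mean_overlap_le q) auto
    finally show ?thesis .
  qed
  have e_lim: "(\<lambda>n. real n * e n) \<longlonglongrightarrow> 0"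
  proof -
    have "(\<lambda>n. (real n * d n - real n * a n * a n) / (1 - (a n)\<^sup>2)\<^sup>2) \<longlonglongrightarrow> (0 - l * 0) / (1 - 0\<^sup>2)\<^sup>2"
      by (intro tendsto_intros d_lim a_lim seq_tendsto_0) auto
    then show ?thesis
      by (simp add: e_def power2_eq_square right_diff_distrib mult.assoc)
  qed
  have e_nonneg: "0 \<le> e n" if "n > 0" for n
    using d_range[OF that] by (simp add: e_def)
  have m1: "(\<lambda>n. spin_mean n (\<lambda>\<sigma>. exp (q * artanh (a n) * (magnetization n \<sigma>)\<^sup>2)))
      \<longlonglongrightarrow> 1 / sqrt (1 - 2 * (q * l))"
  proof (rule Lim_transform_eventually)
    show "(\<lambda>n. spin_mean n (\<lambda>\<sigma>. exp (q * (real n * artanh (a n)) / real n * (magnetization n \<sigma>)\<^sup>2)))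
      \<longlonglongrightarrow> 1 / sqrt (1 - 2 * (q * l))"
      using q by (intro spin_mean_exp_quadratic_tendsto tendsto_mult tendsto_const n_artanh_tendsto
          mult_nonneg_nonneg artanh_seq_nonneg) auto
  qed (rule eventually_mono[OF eventually_gt_at_top[of 0]], simp)
  \<comment> \<open>The conjugate exponent \<open>q / (q - 1)\<close> may be large but is fixed,
    while \<open>n * e n\<close> tends to 0; the overlap average therefore tends to 1.\<close>
  have m2: "(\<lambda>n. spin_mean n (\<lambda>\<sigma>. exp (q / (q - 1) * e n * (magnetization n \<sigma>)\<^sup>2)))
      \<longlonglongrightarrow> 1 / sqrt (1 - 2 * (q / (q - 1) * 0))"
  proof (rule Lim_transform_eventually)
    show "(\<lambda>n. spin_mean n (\<lambda>\<sigma>. exp (q / (q - 1) * (real n * e n) / real n * (magnetization n \<sigma>)\<^sup>2)))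
      \<longlonglongrightarrow> 1 / sqrt (1 - 2 * (q / (q - 1) * 0))"
      using q by (intro spin_mean_exp_quadratic_tendsto tendsto_mult tendsto_const e_lim
          mult_nonneg_nonneg e_nonneg) auto
  qed (rule eventually_mono[OF eventually_gt_at_top[of 0]], simp)
  have "(\<lambda>n. exp ((real n * e n) * (real n * a n) * a n)) \<longlonglongrightarrow> exp (0 * l * 0)"
    by (intro tendsto_intros e_lim a_lim seq_tendsto_0)
  then have ex: "(\<lambda>n. exp (e n * (a n)\<^sup>2 * (real n)\<^sup>2)) \<longlonglongrightarrow> 1"
    by (simp add: power2_eq_square mult_ac)
  have "U \<longlonglongrightarrow> exp (- l\<^sup>2) * 1 * ((1/q) * (1 / sqrt (1 - 2 * (q * l)))\<^sup>2
      + (1 - 1/q) * (1 / sqrt (1 - 2 * (q / (q - 1) * 0))))"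
    unfolding U_def
    by (intro tendsto_mult tendsto_add tendsto_const tendsto_power one_minus_square_power_tendsto ex m1 m2)
  also have "exp (- l\<^sup>2) * 1 * ((1/q) * (1 / sqrt (1 - 2 * (q * l)))\<^sup>2
      + (1 - 1/q) * (1 / sqrt (1 - 2 * (q / (q - 1) * 0)))) = h q"
    using q by (simp add: h_def power_divide)
  finally have "\<forall>\<^sub>F n in sequentially. U n < \<eta>"
    using q(1) by (rule order_tendstoD(2))
  then show ?thesis
    using eventually_gt_at_top[of 0] by eventually_elim (rule le_less_trans[OF le_U])
qed

end

section \<open>Moments over the random graph\<close>

text \<open>The model prescribes only the probabilities of the values 1 and 0. They add up to one,
  so all other values form a null set. The Banach-valued \<open>f\<close> covers real moments and
  characteristic functions alike.\<close>

lemma (in prob_space) has_bochner_integral_bernoulli: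
  fixes f :: "real \<Rightarrow> 'b::{banach, second_countable_topology}"
  assumes [measurable]: "random_variable borel X" "f \<in> borel_measurable borel"
    and p1: "prob {\<omega> \<in> space M. X \<omega> = 1} = p" and p0: "prob {\<omega> \<in> space M. X \<omega> = 0} = 1 - p"
  shows "AE \<omega> in M. X \<omega> = 0 \<or> X \<omega> = 1"
    and "has_bochner_integral M (\<lambda>\<omega>. f (X \<omega>)) ((1 - p) *\<^sub>R f 0 + p *\<^sub>R f 1)"
proof -
  have "prob ({\<omega> \<in> space M. X \<omega> = 0} \<union> {\<omega> \<in> space M. X \<omega> = 1}) = 1"
    by (subst finite_measure_Union) (auto simp: p0 p1)
  then have "prob {\<omega> \<in> space M. X \<omega> = 0 \<or> X \<omega> = 1} = 1"
    by (simp add: Collect_disj_eq[symmetric] Un_def conj_disj_distribL)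
  then show ae: "AE \<omega> in M. X \<omega> = 0 \<or> X \<omega> = 1"
    by (subst (asm) prob_Collect_eq_1) auto
  have "has_bochner_integral M (\<lambda>\<omega>. indicator {\<omega> \<in> space M. X \<omega> = 0} \<omega> *\<^sub>R f 0
      + indicator {\<omega> \<in> space M. X \<omega> = 1} \<omega> *\<^sub>R f 1) ((1 - p) *\<^sub>R f 0 + p *\<^sub>R f 1)"
  proof -
    have "has_bochner_integral M (\<lambda>\<omega>. indicator {\<omega> \<in> space M. X \<omega> = c} \<omega> *\<^sub>R f c)
        (prob {\<omega> \<in> space M. X \<omega> = c} *\<^sub>R f c)" for c
      by (intro has_bochner_integral_indicator) (auto simp: emeasure_eq_measure)
    from has_bochner_integral_add[OF this[of 0] this[of 1]] show ?thesis
      unfolding p0 p1 .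
  qed
  then show "has_bochner_integral M (\<lambda>\<omega>. f (X \<omega>)) ((1 - p) *\<^sub>R f 0 + p *\<^sub>R f 1)"
  proof (rule has_bochner_integral_cong_AE[THEN iffD1, rotated -1])
    show "AE \<omega> in M. indicator {\<omega> \<in> space M. X \<omega> = 0} \<omega> *\<^sub>R f 0
      + indicator {\<omega> \<in> space M. X \<omega> = 1} \<omega> *\<^sub>R f 1 = f (X \<omega>)"
      using ae AE_space by eventually_elim (auto simp: indicator_def)
  qed measurable
qed

text \<open>The factor \<open>W\<close> of the overview when
  \<open>t = tanh \<gamma>\<close>.\<close>

definition high_temperature_mean :: "nat \<Rightarrow> real \<Rightarrow> (nat \<Rightarrow> nat \<Rightarrow> real) \<Rightarrow> real" where
  "high_temperature_mean N t e =
     spin_mean N (\<lambda>\<sigma>. \<Prod>z\<in>edges N. 1 + t * (\<sigma> (fst z) * \<sigma> (snd z)) * e (fst z) (snd z))"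

lemma partition_function_eq_high_temperature_mean:
  fixes p \<beta> :: real and e :: "nat \<Rightarrow> nat \<Rightarrow> real"
  assumes e: "\<And>z. z \<in> edges N \<Longrightarrow> e (fst z) (snd z) = 0 \<or> e (fst z) (snd z) = 1"
  defines "\<gamma> \<equiv> \<beta> / (2 * real N * p)"
  shows "partition_function N p \<beta> e
       = 2 ^ N * exp (ln (cosh \<gamma>) * (\<Sum>z\<in>edges N. e (fst z) (snd z))) * high_temperature_mean N (tanh \<gamma>) e"
proof -
  have "exp (- \<beta> * hamiltonian N p e \<sigma>) = exp (ln (cosh \<gamma>) * (\<Sum>z\<in>edges N. e (fst z) (snd z)))
      * (\<Prod>z\<in>edges N. 1 + tanh \<gamma> * (\<sigma> (fst z) * \<sigma> (snd z)) * e (fst z) (snd z))"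
    if \<sigma>: "\<sigma> \<in> spin_configs N" for \<sigma>
  proof -
    have "- \<beta> * hamiltonian N p e \<sigma> = \<gamma> * (\<Sum>z\<in>edges N. \<sigma> (fst z) * \<sigma> (snd z) * e (fst z) (snd z))"
      by (simp add: hamiltonian_def \<gamma>_def sum.cartesian_product split_def)
    then have "exp (- \<beta> * hamiltonian N p e \<sigma>)
        = (\<Prod>z\<in>edges N. exp (\<gamma> * (\<sigma> (fst z) * \<sigma> (snd z) * e (fst z) (snd z))))"
      by (simp add: sum_distrib_left exp_sum)
    also have "\<dots> = (\<Prod>z\<in>edges N. exp (ln (cosh \<gamma>) * e (fst z) (snd z))
        * (1 + tanh \<gamma> * (\<sigma> (fst z) * \<sigma> (snd z)) * e (fst z) (snd z)))"
    proof (intro prod.cong refl)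
      fix z assume z: "z \<in> edges N"
      have ex: "exp \<gamma> = cosh \<gamma> * (1 + tanh \<gamma>)" "exp (- \<gamma>) = cosh \<gamma> * (1 - tanh \<gamma>)"
        by (simp_all add: tanh_def distrib_left right_diff_distrib cosh_plus_sinh cosh_minus_sinh)
      show "exp (\<gamma> * (\<sigma> (fst z) * \<sigma> (snd z) * e (fst z) (snd z))) = exp (ln (cosh \<gamma>) * e (fst z) (snd z))
        * (1 + tanh \<gamma> * (\<sigma> (fst z) * \<sigma> (snd z)) * e (fst z) (snd z))"
        using e[OF z] spin_configs_mult_cases[OF \<sigma> z] ex by (elim disjE) (simp_all add: cosh_real_pos)
    qed
    also have "\<dots> = exp (ln (cosh \<gamma>) * (\<Sum>z\<in>edges N. e (fst z) (snd z)))
      * (\<Prod>z\<in>edges N. 1 + tanh \<gamma> * (\<sigma> (fst z) * \<sigma> (snd z)) * e (fst z) (snd z))"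
      by (simp add: prod.distrib sum_distrib_left exp_sum)
    finally show ?thesis .
  qed
  then have "partition_function N p \<beta> e = (\<Sum>\<sigma>\<in>spin_configs N. exp (ln (cosh \<gamma>) * (\<Sum>z\<in>edges N. e (fst z) (snd z)))
      * (\<Prod>z\<in>edges N. 1 + tanh \<gamma> * (\<sigma> (fst z) * \<sigma> (snd z)) * e (fst z) (snd z)))"
    unfolding partition_function_def by (rule sum.cong[OF refl])
  then show ?thesis
    by (simp add: high_temperature_mean_def spin_mean_def sum_distrib_left[symmetric])
qed

lemma high_temperature_mean_pos:
  assumes e: "\<And>z. z \<in> edges N \<Longrightarrow> e (fst z) (snd z) = 0 \<or> e (fst z) (snd z) = 1"
    and t: "\<bar>t\<bar> < 1"
  shows "0 < high_temperature_mean N t e"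
proof -
  have "spin_configs N \<noteq> {}"
    using card_spin_configs[of N] by auto
  moreover have "0 < (\<Prod>z\<in>edges N. 1 + t * (\<sigma> (fst z) * \<sigma> (snd z)) * e (fst z) (snd z))"
    if \<sigma>: "\<sigma> \<in> spin_configs N" for \<sigma>
  proof (rule prod_pos)
    fix z assume z: "z \<in> edges N"
    show "0 < 1 + t * (\<sigma> (fst z) * \<sigma> (snd z)) * e (fst z) (snd z)"
      using e[OF z] spin_configs_mult_cases[OF \<sigma> z] t by (elim disjE) simp_all
  qed
  ultimately show ?thesis
    unfolding high_temperature_mean_def spin_mean_def by (intro divide_pos_pos sum_pos) auto
qed

lemma has_bochner_integral_spin_mean:
  assumes "\<And>\<sigma>. has_bochner_integral M (f \<sigma>) (I \<sigma>)"
  shows "has_bochner_integral M (\<lambda>\<omega>. spin_mean N (\<lambda>\<sigma>. f \<sigma> \<omega>)) (spin_mean N I)"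
  unfolding spin_mean_def by (intro has_bochner_integral_divide_zero has_bochner_integral_sum assms)

lemma has_bochner_integral_eq_rhs:
  "has_bochner_integral M f x \<Longrightarrow> x = y \<Longrightarrow> has_bochner_integral M f y"
  by simp

context
  fixes M :: "'a measure" and N :: nat and p :: real and \<epsilon> :: "nat \<Rightarrow> nat \<Rightarrow> 'a \<Rightarrow> real"
  assumes graph: "directed_erdos_renyi M N p \<epsilon>"
begin

interpretation prob_space M
  using graph by (simp add: directed_erdos_renyi_def)

lemma edge_indep: "indep_vars (\<lambda>_. borel) (\<lambda>z. \<epsilon> (fst z) (snd z)) (edges N)"
  using graph by (simp add: directed_erdos_renyi_def split_def)

lemma edge_measurable: "random_variable borel (\<epsilon> (fst z) (snd z))" if "z \<in> edges N"
  using edge_indep that unfolding indep_vars_def2 by auto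

lemma edge_prob:
  assumes "z \<in> edges N"
  shows "prob {\<omega> \<in> space M. \<epsilon> (fst z) (snd z) \<omega> = 1} = p"
    and "prob {\<omega> \<in> space M. \<epsilon> (fst z) (snd z) \<omega> = 0} = 1 - p"
  using graph assms unfolding directed_erdos_renyi_def by auto

lemma edges_AE: "AE \<omega> in M. \<forall>z\<in>edges N. \<epsilon> (fst z) (snd z) \<omega> = 0 \<or> \<epsilon> (fst z) (snd z) \<omega> = 1"
proof (subst AE_ball_countable)
  show "\<forall>z\<in>edges N. AE \<omega> in M. \<epsilon> (fst z) (snd z) \<omega> = 0 \<or> \<epsilon> (fst z) (snd z) \<omega> = 1"
    using has_bochner_integral_bernoulli(1)[OF edge_measurable _ edge_prob, where f="\<lambda>_. 0::real"] by auto
qed (auto intro: countable_finite)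

lemma edges_prod_expectation:
  fixes f :: "nat \<times> nat \<Rightarrow> real \<Rightarrow> 'b::{real_normed_field, banach, second_countable_topology}"
  assumes f: "\<And>z. z \<in> edges N \<Longrightarrow> f z \<in> borel_measurable borel"
  shows "has_bochner_integral M (\<lambda>\<omega>. \<Prod>z\<in>edges N. f z (\<epsilon> (fst z) (snd z) \<omega>))
           (\<Prod>z\<in>edges N. (1 - p) *\<^sub>R f z 0 + p *\<^sub>R f z 1)"
proof -
  have hb: "has_bochner_integral M (\<lambda>\<omega>. f z (\<epsilon> (fst z) (snd z) \<omega>)) ((1 - p) *\<^sub>R f z 0 + p *\<^sub>R f z 1)"
    if "z \<in> edges N" for z
    using that by (intro has_bochner_integral_bernoulli edge_measurable edge_prob f)
  have ind: "indep_vars (\<lambda>_. borel) (\<lambda>z \<omega>. f z (\<epsilon> (fst z) (snd z) \<omega>)) (edges N)"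
    by (rule indep_vars_compose2[OF edge_indep]) (rule f)
  have int: "integrable M (\<lambda>\<omega>. f z (\<epsilon> (fst z) (snd z) \<omega>))" if "z \<in> edges N" for z
    using hb[OF that] by (simp add: has_bochner_integral_iff)
  have "integrable M (\<lambda>\<omega>. \<Prod>z\<in>edges N. f z (\<epsilon> (fst z) (snd z) \<omega>))"
    by (rule indep_vars_integrable[OF _ ind int]) auto
  moreover have "(\<integral>\<omega>. (\<Prod>z\<in>edges N. f z (\<epsilon> (fst z) (snd z) \<omega>)) \<partial>M)
      = (\<Prod>z\<in>edges N. \<integral>\<omega>. f z (\<epsilon> (fst z) (snd z) \<omega>) \<partial>M)"
    by (rule indep_vars_lebesgue_integral[OF _ ind int]) auto
  moreover have "\<dots> = (\<Prod>z\<in>edges N. (1 - p) *\<^sub>R f z 0 + p *\<^sub>R f z 1)"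
    by (intro prod.cong refl has_bochner_integral_integral_eq hb)
  ultimately show ?thesis
    unfolding has_bochner_integral_iff by simp
qed

lemma high_temperature_mean_first_moment:
  "has_bochner_integral M (\<lambda>\<omega>. high_temperature_mean N t (\<lambda>i j. \<epsilon> i j \<omega>)) (spin_pair_mean N (p * t))"
  unfolding high_temperature_mean_def spin_pair_mean_def
proof (rule has_bochner_integral_spin_mean)
  fix \<sigma>
  have "has_bochner_integral M (\<lambda>\<omega>. \<Prod>z\<in>edges N. 1 + t * (\<sigma> (fst z) * \<sigma> (snd z)) * \<epsilon> (fst z) (snd z) \<omega>)
      (\<Prod>z\<in>edges N. (1 - p) *\<^sub>R (1 + t * (\<sigma> (fst z) * \<sigma> (snd z)) * 0)
        + p *\<^sub>R (1 + t * (\<sigma> (fst z) * \<sigma> (snd z)) * 1))"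
    by (rule edges_prod_expectation) measurable
  then show "has_bochner_integral M (\<lambda>\<omega>. \<Prod>z\<in>edges N. 1 + t * (\<sigma> (fst z) * \<sigma> (snd z)) * \<epsilon> (fst z) (snd z) \<omega>)
      (\<Prod>z\<in>edges N. 1 + p * t * (\<sigma> (fst z) * \<sigma> (snd z)))"
    by (rule has_bochner_integral_eq_rhs) (intro prod.cong refl, simp add: algebra_simps)
qed

text \<open>The square is an average over two replicas, after which independence applies edge by
  edge.\<close>

lemma high_temperature_mean_second_moment:
  "has_bochner_integral M (\<lambda>\<omega>. (high_temperature_mean N t (\<lambda>i j. \<epsilon> i j \<omega>))\<^sup>2)
     (spin_pair_overlap_mean N (p * t) (p * t\<^sup>2))"
proof -
  define g where "g \<sigma> \<omega> z = 1 + t * (\<sigma> (fst z) * \<sigma> (snd z)) * \<epsilon> (fst z) (snd z) \<omega>"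
    for \<sigma> :: "nat \<Rightarrow> real" and \<omega> z
  have "(high_temperature_mean N t (\<lambda>i j. \<epsilon> i j \<omega>))\<^sup>2
      = spin_mean N (\<lambda>\<sigma>. spin_mean N (\<lambda>\<tau>. \<Prod>z\<in>edges N. g \<sigma> \<omega> z * g \<tau> \<omega> z))" for \<omega>
    unfolding prod.distrib spin_mean_cmult spin_mean_cmult_right power2_eq_square
      high_temperature_mean_def g_def ..
  moreover have "has_bochner_integral M (\<lambda>\<omega>. spin_mean N (\<lambda>\<sigma>. spin_mean N (\<lambda>\<tau>. \<Prod>z\<in>edges N. g \<sigma> \<omega> z * g \<tau> \<omega> z)))
     (spin_pair_overlap_mean N (p * t) (p * t\<^sup>2))"
    unfolding spin_pair_overlap_mean_def
  proof (intro has_bochner_integral_spin_mean)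
    fix \<sigma> \<tau>
    have "has_bochner_integral M (\<lambda>\<omega>. \<Prod>z\<in>edges N. g \<sigma> \<omega> z * g \<tau> \<omega> z)
        (\<Prod>z\<in>edges N. (1 - p) *\<^sub>R ((1 + t * (\<sigma> (fst z) * \<sigma> (snd z)) * 0) * (1 + t * (\<tau> (fst z) * \<tau> (snd z)) * 0))
          + p *\<^sub>R ((1 + t * (\<sigma> (fst z) * \<sigma> (snd z)) * 1) * (1 + t * (\<tau> (fst z) * \<tau> (snd z)) * 1)))"
      unfolding g_def
      by (rule edges_prod_expectation[where f="\<lambda>z x. (1 + t * (\<sigma> (fst z) * \<sigma> (snd z)) * x) * (1 + t * (\<tau> (fst z) * \<tau> (snd z)) * x)"]) measurable
    then show "has_bochner_integral M (\<lambda>\<omega>. \<Prod>z\<in>edges N. g \<sigma> \<omega> z * g \<tau> \<omega> z)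
        (\<Prod>z\<in>edges N. 1 + p * t * (\<sigma> (fst z) * \<sigma> (snd z) + \<tau> (fst z) * \<tau> (snd z))
          + p * t\<^sup>2 * ((\<sigma> (fst z) * \<sigma> (snd z)) * (\<tau> (fst z) * \<tau> (snd z))))"
      by (rule has_bochner_integral_eq_rhs) (intro prod.cong refl, simp add: algebra_simps power2_eq_square)
  qed
  ultimately show ?thesis by simp
qed

text \<open>The deviation is taken from a free constant, to be chosen as the deterministic limit of
  \<open>W\<close> rather than its mean.\<close>

lemma high_temperature_mean_deviation:
  "has_bochner_integral M (\<lambda>\<omega>. (high_temperature_mean N t (\<lambda>i j. \<epsilon> i j \<omega>) - L)\<^sup>2)
     (spin_pair_overlap_mean N (p * t) (p * t\<^sup>2) - 2 * L * spin_pair_mean N (p * t) + L\<^sup>2)"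
proof -
  have "has_bochner_integral M (\<lambda>\<omega>. (high_temperature_mean N t (\<lambda>i j. \<epsilon> i j \<omega>))\<^sup>2
      - 2 * L * high_temperature_mean N t (\<lambda>i j. \<epsilon> i j \<omega>) + L\<^sup>2)
     (spin_pair_overlap_mean N (p * t) (p * t\<^sup>2) - 2 * L * spin_pair_mean N (p * t) + L\<^sup>2)"
    by (intro has_bochner_integral_add has_bochner_integral_diff has_bochner_integral_mult_right
          high_temperature_mean_first_moment high_temperature_mean_second_moment)
       (simp add: has_bochner_integral_iff prob_space)
  then show ?thesis
    by (simp add: power2_diff algebra_simps)
qed

lemma char_centered_edge_sum:
  "char (distr M borel (\<lambda>\<omega>. s * ((\<Sum>z\<in>edges N. \<epsilon> (fst z) (snd z) \<omega>) - real (N\<^sup>2) * p))) \<theta>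
     = ((1 - p) *\<^sub>R iexp (- (\<theta> * s * p)) + p *\<^sub>R iexp (\<theta> * s * (1 - p))) ^ N\<^sup>2"
proof -
  have [measurable]: "random_variable borel (\<lambda>\<omega>. \<Sum>z\<in>edges N. \<epsilon> (fst z) (snd z) \<omega>)"
    by (intro borel_measurable_sum edge_measurable)
  have "char (distr M borel (\<lambda>\<omega>. s * ((\<Sum>z\<in>edges N. \<epsilon> (fst z) (snd z) \<omega>) - real (N\<^sup>2) * p))) \<theta>
      = (CLINT \<omega>|M. iexp (\<theta> * (s * ((\<Sum>z\<in>edges N. \<epsilon> (fst z) (snd z) \<omega>) - real (N\<^sup>2) * p))))"
    unfolding char_def by (subst integral_distr) measurable
  also have "\<dots> = (CLINT \<omega>|M. \<Prod>z\<in>edges N. iexp (\<theta> * s * (\<epsilon> (fst z) (snd z) \<omega> - p)))"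
  proof (intro Bochner_Integration.integral_cong refl)
    fix \<omega>
    have "\<theta> * (s * ((\<Sum>z\<in>edges N. \<epsilon> (fst z) (snd z) \<omega>) - real (N\<^sup>2) * p))
        = (\<Sum>z\<in>edges N. \<theta> * s * (\<epsilon> (fst z) (snd z) \<omega> - p))"
      by (simp add: sum_distrib_left[symmetric] sum_subtractf power2_eq_square)
    then show "iexp (\<theta> * (s * ((\<Sum>z\<in>edges N. \<epsilon> (fst z) (snd z) \<omega>) - real (N\<^sup>2) * p)))
        = (\<Prod>z\<in>edges N. iexp (\<theta> * s * (\<epsilon> (fst z) (snd z) \<omega> - p)))"
      by (simp only: of_real_sum sum_distrib_left exp_sum finite_cartesian_product finite_atLeastAtMost)
  qed
  also have "\<dots> = (\<Prod>z\<in>edges N. (1 - p) *\<^sub>R iexp (\<theta> * s * (0 - p)) + p *\<^sub>R iexp (\<theta> * s * (1 - p)))"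
    by (intro has_bochner_integral_integral_eq
          edges_prod_expectation[where f="\<lambda>z x. iexp (\<theta> * s * (x - p))"]) measurable
  also have "\<dots> = ((1 - p) *\<^sub>R iexp (- (\<theta> * s * p)) + p *\<^sub>R iexp (\<theta> * s * (1 - p))) ^ N\<^sup>2"
    by (simp add: power2_eq_square)
  finally show ?thesis .
qed

end

section \<open>Asymptotics of the parameters\<close>

context
  fixes p :: "nat \<Rightarrow> real" and \<beta> c :: real and \<gamma> :: "nat \<Rightarrow> real"
  defines "\<gamma> \<equiv> \<lambda>N. \<beta> / (2 * real N * p N)"
  assumes p_range: "\<And>N. N \<ge> 1 \<Longrightarrow> 0 < p N \<and> p N \<le> 1"
    and beta: "0 < \<beta>" "\<beta> < 1" and c_pos: "0 < c"
    and p_lim: "(\<lambda>N. p N ^ 3 * real N ^ 2) \<longlonglongrightarrow> c"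
begin

lemma gamma_pos: "0 < \<gamma> N" if "N \<ge> 1"
  using p_range[OF that] beta that by (simp add: \<gamma>_def)

lemma p_tendsto_0: "p \<longlonglongrightarrow> 0"
proof -
  have "(\<lambda>N. root 3 (p N ^ 3 * real N ^ 2 * (1 / real N)\<^sup>2)) \<longlonglongrightarrow> root 3 (c * 0\<^sup>2)"
    by (intro tendsto_intros p_lim lim_1_over_n)
  then have "(\<lambda>N. root 3 (p N ^ 3 * real N ^ 2 * (1 / real N)\<^sup>2)) \<longlonglongrightarrow> 0"
    by simp
  moreover have "\<forall>\<^sub>F N in sequentially. root 3 (p N ^ 3 * real N ^ 2 * (1 / real N)\<^sup>2) = p N"
    using eventually_ge_at_top[of 1]
    by eventually_elim (simp add: power_divide odd_real_root_power_cancel)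
  ultimately show ?thesis by (rule Lim_transform_eventually)
qed

text \<open>Only \<open>p^3 N\<^sup>2\<close> is controlled, so cubes are compared:
  \<open>\<gamma>^3\<close> is \<open>\<beta>^3 / 8\<close> divided by \<open>p^3 N\<^sup>2\<close>
  and by \<open>N\<close>.\<close>

lemma gamma_tendsto_0: "\<gamma> \<longlonglongrightarrow> 0"
proof -
  have "(\<lambda>N. root 3 (\<beta> ^ 3 / 8 * (1 / (p N ^ 3 * real N ^ 2)) * (1 / real N))) \<longlonglongrightarrow> root 3 (\<beta> ^ 3 / 8 * (1 / c) * 0)"
    using c_pos by (intro tendsto_intros p_lim lim_1_over_n) auto
  then have "(\<lambda>N. root 3 (\<beta> ^ 3 / 8 * (1 / (p N ^ 3 * real N ^ 2)) * (1 / real N))) \<longlonglongrightarrow> 0"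
    by simp
  moreover have "\<forall>\<^sub>F N in sequentially. root 3 (\<beta> ^ 3 / 8 * (1 / (p N ^ 3 * real N ^ 2)) * (1 / real N)) = \<gamma> N"
    using eventually_ge_at_top[of 1]
  proof eventually_elim
    case (elim N)
    have "\<beta> ^ 3 / 8 * (1 / (p N ^ 3 * real N ^ 2)) * (1 / real N) = \<gamma> N ^ 3"
      by (simp add: \<gamma>_def power_divide power_mult_distrib eval_nat_numeral)
    then show ?case
      by (simp add: odd_real_root_power_cancel)
  qed
  ultimately show ?thesis by (rule Lim_transform_eventually)
qed

lemma gamma_at_right: "filterlim \<gamma> (at_right 0) sequentially"
  unfolding filterlim_at
proof
  show "\<forall>\<^sub>F N in sequentially. \<gamma> N \<in> {0<..} \<and> \<gamma> N \<noteq> 0"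
    using eventually_ge_at_top[of 1] by eventually_elim (use gamma_pos in force)
qed (rule gamma_tendsto_0)

lemma edges_gamma4_tendsto: "(\<lambda>N. real (N\<^sup>2) * p N * \<gamma> N ^ 4) \<longlonglongrightarrow> \<beta> ^ 4 / (16 * c)"
proof (rule Lim_transform_eventually)
  show "(\<lambda>N. \<beta> ^ 4 / (16 * (p N ^ 3 * real N ^ 2))) \<longlonglongrightarrow> \<beta> ^ 4 / (16 * c)"
    using c_pos by (intro tendsto_intros p_lim) auto
  show "\<forall>\<^sub>F N in sequentially. \<beta> ^ 4 / (16 * (p N ^ 3 * real N ^ 2)) = real (N\<^sup>2) * p N * \<gamma> N ^ 4"
    using eventually_ge_at_top[of 1]
  proof eventually_elim
    case (elim N)
    then show ?case
      using p_range[OF elim] by (simp add: \<gamma>_def power_divide power_mult_distrib eval_nat_numeral)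
  qed
qed

text \<open>\<open>N * p * \<gamma>\<close> is exactly \<open>\<beta> / 2\<close>; the limit lies
  below \<open>1/2\<close> precisely because \<open>\<beta> < 1\<close>.\<close>

lemma n_p_tanh_gamma_tendsto: "(\<lambda>N. real N * (p N * tanh (\<gamma> N))) \<longlonglongrightarrow> \<beta> / 2"
proof (rule Lim_transform_eventually)
  have "((\<lambda>x::real. tanh x / x) \<longlongrightarrow> 1) (at_right 0)"
    by real_asymp
  from tendsto_mult[OF tendsto_const[of "\<beta> / 2"] filterlim_compose[OF this gamma_at_right]]
  show "(\<lambda>N. \<beta> / 2 * (tanh (\<gamma> N) / \<gamma> N)) \<longlonglongrightarrow> \<beta> / 2"
    by simp
  show "\<forall>\<^sub>F N in sequentially. \<beta> / 2 * (tanh (\<gamma> N) / \<gamma> N) = real N * (p N * tanh (\<gamma> N))"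
    using eventually_ge_at_top[of 1]
  proof eventually_elim
    case (elim N)
    have "\<beta> / 2 = real N * p N * \<gamma> N"
      using p_range[OF elim] elim by (simp add: \<gamma>_def)
    with gamma_pos[OF elim] show ?case
      by simp
  qed
qed

lemma tanh_gamma_tendsto_0: "(\<lambda>N. tanh (\<gamma> N)) \<longlonglongrightarrow> 0"
proof -
  have "isCont (tanh :: real \<Rightarrow> real) 0"
    by (intro continuous_intros) auto
  from isCont_tendsto_compose[OF this gamma_tendsto_0] show ?thesis by simp
qed

text \<open>The constant is \<open>1/16\<close> times \<open>(1/2)\<^sup>2\<close>, from
  \<open>ln (cosh x) ~ x\<^sup>2 / 2\<close>.\<close>

lemma edges_ln_cosh_variance_tendsto:
  "(\<lambda>N. real (N\<^sup>2) * p N * (ln (cosh (\<gamma> N)))\<^sup>2) \<longlonglongrightarrow> \<beta> ^ 4 / (64 * c)"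
proof (rule Lim_transform_eventually)
  have "((\<lambda>x::real. ln (cosh x) / x\<^sup>2) \<longlongrightarrow> 1 / 2) (at_right 0)"
    by real_asymp
  from tendsto_mult[OF edges_gamma4_tendsto tendsto_power[OF filterlim_compose[OF this gamma_at_right], of 2]]
  show "(\<lambda>N. real (N\<^sup>2) * p N * \<gamma> N ^ 4 * (ln (cosh (\<gamma> N)) / (\<gamma> N)\<^sup>2)\<^sup>2) \<longlonglongrightarrow> \<beta> ^ 4 / (64 * c)"
    by (simp add: power_divide)
  show "\<forall>\<^sub>F N in sequentially. real (N\<^sup>2) * p N * \<gamma> N ^ 4 * (ln (cosh (\<gamma> N)) / (\<gamma> N)\<^sup>2)\<^sup>2
      = real (N\<^sup>2) * p N * (ln (cosh (\<gamma> N)))\<^sup>2"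
    using eventually_ge_at_top[of 1]
  proof eventually_elim
    case (elim N)
    then show ?case
      using gamma_pos[OF elim] by (simp add: power_divide)
  qed
qed

text \<open>The quadratic term of \<open>ln (cosh \<gamma>)\<close> reproduces
  \<open>\<beta>\<^sup>2 / (8 * p)\<close> without error. The quartic term leaves
  \<open>1/16\<close> times \<open>- 1/12\<close>.\<close>

lemma edges_ln_cosh_mean_tendsto:
  "(\<lambda>N. real (N\<^sup>2) * p N * ln (cosh (\<gamma> N)) - \<beta>\<^sup>2 / (8 * p N)) \<longlonglongrightarrow> - (\<beta> ^ 4 / (192 * c))"
proof (rule Lim_transform_eventually)
  have "((\<lambda>x::real. (ln (cosh x) - x\<^sup>2 / 2) / x ^ 4) \<longlongrightarrow> - 1 / 12) (at_right 0)"
    by real_asymp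
  from tendsto_mult[OF edges_gamma4_tendsto filterlim_compose[OF this gamma_at_right]]
  show "(\<lambda>N. real (N\<^sup>2) * p N * \<gamma> N ^ 4 * ((ln (cosh (\<gamma> N)) - (\<gamma> N)\<^sup>2 / 2) / \<gamma> N ^ 4)) \<longlonglongrightarrow> - (\<beta> ^ 4 / (192 * c))"
    by simp
  show "\<forall>\<^sub>F N in sequentially. real (N\<^sup>2) * p N * \<gamma> N ^ 4 * ((ln (cosh (\<gamma> N)) - (\<gamma> N)\<^sup>2 / 2) / \<gamma> N ^ 4)
      = real (N\<^sup>2) * p N * ln (cosh (\<gamma> N)) - \<beta>\<^sup>2 / (8 * p N)"
    using eventually_ge_at_top[of 1]
  proof eventually_elim
    case (elim N)
    have "\<beta>\<^sup>2 / (8 * p N) = real (N\<^sup>2) * p N * ((\<gamma> N)\<^sup>2 / 2)"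
      using p_range[OF elim] elim by (simp add: \<gamma>_def power_divide power_mult_distrib power2_eq_square)
    moreover have "real (N\<^sup>2) * p N * \<gamma> N ^ 4 * ((ln (cosh (\<gamma> N)) - (\<gamma> N)\<^sup>2 / 2) / \<gamma> N ^ 4)
        = real (N\<^sup>2) * p N * (ln (cosh (\<gamma> N)) - (\<gamma> N)\<^sup>2 / 2)"
      using gamma_pos[OF elim] by simp
    ultimately show ?case
      by (simp only: right_diff_distrib)
  qed
qed

lemma ln_cosh_gamma_tendsto_0: "(\<lambda>N. ln (cosh (\<gamma> N))) \<longlonglongrightarrow> 0"
proof -
  have "(\<lambda>N. ln (cosh (\<gamma> N))) \<longlonglongrightarrow> ln (cosh 0)"
    by (intro tendsto_intros gamma_tendsto_0) simp
  then show ?thesis by simp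
qed

text \<open>The bound on the second moment and the limit of the first leave at most
  \<open>L\<^sup>2 - 2 * L\<^sup>2 + L\<^sup>2 = 0\<close>. The other side is \<open>nonneg\<close>,
  later obtained because \<open>D N L\<close> is the integral of a square.\<close>

lemma high_temperature_deviation_tendsto_0:
  defines "L \<equiv> exp (- (\<beta> / 2)\<^sup>2 / 2) / sqrt (1 - 2 * (\<beta> / 2))"
    and "D \<equiv> \<lambda>N L. spin_pair_overlap_mean N (p N * tanh (\<gamma> N)) (p N * (tanh (\<gamma> N))\<^sup>2)
           - 2 * L * spin_pair_mean N (p N * tanh (\<gamma> N)) + L\<^sup>2"
  assumes nonneg: "\<And>N. N \<ge> 1 \<Longrightarrow> 0 \<le> D N L"
  shows "(\<lambda>N. D N L) \<longlonglongrightarrow> 0"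
proof (rule tendstoI)
  fix \<eta> :: real assume \<eta>: "0 < \<eta>"
  let ?a = "\<lambda>N. p N * tanh (\<gamma> N)" and ?d = "\<lambda>N. p N * (tanh (\<gamma> N))\<^sup>2"
  have a_range: "0 \<le> ?a N \<and> ?a N < 1" if "N > 0" for N
  proof -
    have "0 < p N" "p N \<le> 1" "0 < tanh (\<gamma> N)" "tanh (\<gamma> N) < 1"
      using p_range[of N] gamma_pos[of N] that tanh_real_lt_1 by auto
    then show ?thesis
      using mult_le_less_imp_less[of "p N" 1 "tanh (\<gamma> N)" 1] by simp
  qed
  have d_range: "(?a N)\<^sup>2 \<le> ?d N \<and> ?d N \<le> 1" if "N > 0" for N
  proof -
    have p: "0 < p N" "p N \<le> 1" and t: "\<bar>tanh (\<gamma> N)\<bar> \<le> 1"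
      using p_range[of N] that tanh_real_bounds[of "\<gamma> N"] by auto
    have "(tanh (\<gamma> N))\<^sup>2 \<le> 1"
      using t by (simp add: abs_square_le_1)
    then have "?d N \<le> 1 * 1"
      using p by (intro mult_mono) auto
    moreover have "(p N)\<^sup>2 \<le> p N"
      using p by (simp add: power2_eq_square mult_left_le_one_le)
    ultimately show ?thesis
      by (auto simp: power_mult_distrib intro!: mult_right_mono)
  qed
  \<comment> \<open>The replica coupling is \<open>N * p * tanh \<gamma>\<close>, which converges,
    times one more factor \<open>tanh \<gamma>\<close>, which vanishes.\<close>
  have d_lim: "(\<lambda>N. real N * ?d N) \<longlonglongrightarrow> 0"
    using tendsto_mult[OF n_p_tanh_gamma_tendsto tanh_gamma_tendsto_0]
    by (simp add: power2_eq_square mult.assoc)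
  have L2: "L\<^sup>2 = exp (- (\<beta> / 2)\<^sup>2) / (1 - 2 * (\<beta> / 2))"
    using beta by (simp add: L_def power_divide exp_double[symmetric])
  have "\<forall>\<^sub>F N in sequentially. spin_pair_overlap_mean N (?a N) (?d N) < L\<^sup>2 + \<eta> / 2"
    using beta \<eta> L2
    by (intro spin_pair_overlap_mean_upper[OF a_range n_p_tanh_gamma_tendsto _ d_range d_lim]) auto
  moreover have "(\<lambda>N. 2 * L * spin_pair_mean N (?a N)) \<longlonglongrightarrow> 2 * L * L"
    unfolding L_def using beta
    by (intro tendsto_mult[OF tendsto_const] spin_pair_mean_tendsto[OF a_range n_p_tanh_gamma_tendsto]) auto
  then have "\<forall>\<^sub>F N in sequentially. 2 * L * L - \<eta> / 2 < 2 * L * spin_pair_mean N (?a N)"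
    using \<eta> by (intro order_tendstoD(1)) auto
  ultimately show "\<forall>\<^sub>F N in sequentially. dist (D N L) 0 < \<eta>"
    using eventually_ge_at_top[of 1]
  proof eventually_elim
    case (elim N)
    then show ?case
      using nonneg[OF elim(3)] by (simp add: D_def power2_eq_square)
  qed
qed

end

section \<open>The limit theorem\<close>

lemma high_temperature_limit_ln:
  assumes "\<beta> < 1"
  shows "ln (exp (- (\<beta> / 2)\<^sup>2 / 2) / sqrt (1 - 2 * (\<beta> / 2))) = - \<beta>\<^sup>2 / 8 - 1 / 2 * ln (1 - \<beta>)"
  using assms by (simp add: ln_div ln_sqrt power_divide)

theorem theorem1p3:
  fixes M :: "nat \<Rightarrow> 'a measure"
    and p :: "nat \<Rightarrow> real"
    and \<epsilon> :: "nat \<Rightarrow> nat \<Rightarrow> nat \<Rightarrow> 'a \<Rightarrow> real"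
    and \<beta> c :: real
    and Z :: "nat \<Rightarrow> 'a \<Rightarrow> real"
  defines "Z \<equiv> \<lambda>N \<omega>. partition_function N (p N) \<beta> (\<lambda>i j. \<epsilon> N i j \<omega>)"
  assumes p_range: "\<And>N. N \<ge> 1 \<Longrightarrow> 0 < p N \<and> p N \<le> 1"
    and graph: "\<And>N. N \<ge> 1 \<Longrightarrow> directed_erdos_renyi (M N) N (p N) (\<epsilon> N)"
    and beta: "0 < \<beta>" "\<beta> < 1"
    and c_pos: "0 < c"
    and p_lim: "(\<lambda>N. p N ^ 3 * real N ^ 2) \<longlonglongrightarrow> c"
  shows "weak_conv_m
           (\<lambda>N. distr (M N) borel
              (\<lambda>\<omega>. ln (Z N \<omega>) - real N * ln 2 - \<beta>\<^sup>2 * (1 - p N) / (8 * p N)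
                     + 1 / 2 * ln (1 - \<beta>) + \<beta> ^ 4 / (192 * c)))
           (centered_normal (\<beta> ^ 4 / (64 * c)))
       \<and> weak_conv_m
           (\<lambda>N. distr (M N) borel
              (\<lambda>\<omega>. sqrt (1 - \<beta>) *
                   (Z N \<omega> / (2 ^ N * exp (\<beta>\<^sup>2 * (1 - p N) / (8 * p N) - \<beta> ^ 4 / (192 * c)))))
           )
           (distr std_normal_distribution borel (\<lambda>\<xi>. exp (\<beta>\<^sup>2 * \<xi> / (8 * sqrt c))))"
proof -
  define \<gamma> where "\<gamma> N = \<beta> / (2 * real N * p N)" for N
  define s where "s N = ln (cosh (\<gamma> N))" for N
  define L where "L = exp (- (\<beta> / 2)\<^sup>2 / 2) / sqrt (1 - 2 * (\<beta> / 2))"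
  define S where "S N \<omega> = (\<Sum>z\<in>edges N. \<epsilon> N (fst z) (snd z) \<omega>)" for N \<omega>
  define W where "W N \<omega> = high_temperature_mean N (tanh (\<gamma> N)) (\<lambda>i j. \<epsilon> N i j \<omega>)" for N \<omega>
  \<comment> \<open>\<open>X\<close> carries the Gaussian limit; \<open>Y\<close> gathers the
    deterministic drift \<open>r\<close> and the fluctuation of \<open>ln W\<close>, both of which
    vanish.\<close>
  define X where "X N \<omega> = s N * (S N \<omega> - real (N\<^sup>2) * p N)" for N \<omega>
  define r where "r N = real (N\<^sup>2) * p N * s N - \<beta>\<^sup>2 / (8 * p N) + \<beta> ^ 4 / (192 * c)" for N
  define Y where "Y N \<omega> = r N + (ln (W N \<omega>) - ln L)" for N \<omega>
  define T where "T N \<omega> = ln (Z N \<omega>) - real N * ln 2 - \<beta>\<^sup>2 * (1 - p N) / (8 * p N)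
                     + 1 / 2 * ln (1 - \<beta>) + \<beta> ^ 4 / (192 * c)" for N \<omega>
  define v where "v = \<beta> ^ 4 / (64 * c)"
  have v: "0 < v" using beta c_pos by (simp add: v_def)
  have L: "0 < L" using beta by (simp add: L_def)
  have prob: "prob_space (M N)" if "N > 0" for N
    using graph[of N] that by (simp add: directed_erdos_renyi_def)
  have \<epsilon>_meas: "\<epsilon> N (fst z) (snd z) \<in> borel_measurable (M N)" if "N > 0" "z \<in> edges N" for N z
    using edge_measurable[OF graph that(2)] that(1) by simp
  have S_meas: "S N \<in> borel_measurable (M N)" if "N > 0" for N
    unfolding S_def by (intro borel_measurable_sum \<epsilon>_meas that)
  have X_meas: "X N \<in> borel_measurable (M N)" if "N > 0" for N
    using S_meas[OF that] unfolding X_def by measurable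
  have W_meas: "W N \<in> borel_measurable (M N)" if "N > 0" for N
    using high_temperature_mean_first_moment[OF graph, of N "tanh (\<gamma> N)"] that
    unfolding W_def by (auto simp: has_bochner_integral_iff)
  have Y_meas: "Y N \<in> borel_measurable (M N)" if "N > 0" for N
    using W_meas[OF that] unfolding Y_def by measurable
  have Z_meas: "Z N \<in> borel_measurable (M N)" if "N > 0" for N
  proof -
    have \<epsilon>: "\<epsilon> N i j \<in> borel_measurable (M N)" if "i \<in> {1..N}" "j \<in> {1..N}" for i j
      using \<epsilon>_meas[OF \<open>N > 0\<close>, of "(i, j)"] that by simp
    show ?thesis
      unfolding Z_def partition_function_def hamiltonian_def
      by (intro borel_measurable_sum borel_measurable_exp[THEN measurable_compose[rotated]]
            borel_measurable_times borel_measurable_const \<epsilon>)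
  qed
  have T_meas: "T N \<in> borel_measurable (M N)" if "N > 0" for N
    using Z_meas[OF that] unfolding T_def by measurable
  \<comment> \<open>The indicators take the values 0 and 1 only up to a null set, so the
    factorisation is almost sure.\<close>
  have factor: "AE \<omega> in M N. 0 < W N \<omega> \<and> Z N \<omega> = 2 ^ N * exp (s N * S N \<omega>) * W N \<omega>" if "N > 0" for N
  proof -
    have "AE \<omega> in M N. \<forall>z\<in>edges N. \<epsilon> N (fst z) (snd z) \<omega> = 0 \<or> \<epsilon> N (fst z) (snd z) \<omega> = 1"
      using that by (intro edges_AE[OF graph]) simp
    then show ?thesis
    proof eventually_elim
      case (elim \<omega>)
      have "\<bar>tanh (\<gamma> N)\<bar> < 1"
        using tanh_real_bounds[of "\<gamma> N"] by auto
      moreover have "\<epsilon> N (fst z) (snd z) \<omega> = 0 \<or> \<epsilon> N (fst z) (snd z) \<omega> = 1" if "z \<in> edges N" for z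
        using elim that by (rule bspec)
      ultimately show ?case
        unfolding W_def Z_def s_def S_def \<gamma>_def
        by (intro conjI high_temperature_mean_pos partition_function_eq_high_temperature_mean)
    qed
  qed
  have T_eq: "AE \<omega> in M N. T N \<omega> = X N \<omega> + Y N \<omega>" if "N > 0" for N
    using factor[OF that]
  proof eventually_elim
    case (elim \<omega>)
    have "ln (Z N \<omega>) = real N * ln 2 + s N * S N \<omega> + ln (W N \<omega>)"
      using elim by (simp add: ln_mult ln_realpow)
    \<comment> \<open>The constant \<open>\<beta>\<^sup>2 / 8\<close> split off here, together with
      \<open>1 / 2 * ln (1 - \<beta>)\<close>, is exactly \<open>- ln L\<close>.\<close>
    moreover have "\<beta>\<^sup>2 * (1 - p N) / (8 * p N) = \<beta>\<^sup>2 / (8 * p N) - \<beta>\<^sup>2 / 8"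
      using p_range[of N] that by (simp add: field_simps)
    moreover have "ln L = - \<beta>\<^sup>2 / 8 - 1 / 2 * ln (1 - \<beta>)"
      unfolding L_def by (rule high_temperature_limit_ln[OF beta(2)])
    ultimately show ?case
      by (simp add: T_def X_def Y_def r_def right_diff_distrib mult_ac)
  qed
  have Y_lim: "(\<lambda>N. measure (M N) {\<omega> \<in> space (M N). \<delta> \<le> \<bar>Y N \<omega>\<bar>}) \<longlonglongrightarrow> 0" if \<delta>: "0 < \<delta>" for \<delta>
  proof -
    define D where "D N = spin_pair_overlap_mean N (p N * tanh (\<gamma> N)) (p N * (tanh (\<gamma> N))\<^sup>2)
           - 2 * L * spin_pair_mean N (p N * tanh (\<gamma> N)) + L\<^sup>2" for N
    have D: "has_bochner_integral (M N) (\<lambda>\<omega>. (W N \<omega> - L)\<^sup>2) (D N)" if "N \<ge> 1" for N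
      unfolding W_def D_def by (rule high_temperature_mean_deviation[OF graph[OF that]])
    have D_nonneg: "0 \<le> D N" if "N \<ge> 1" for N
      unfolding has_bochner_integral_integral_eq[OF D[OF that], symmetric]
      by (rule integral_nonneg_AE) simp
    have D_lim: "D \<longlonglongrightarrow> 0"
      using high_temperature_deviation_tendsto_0[OF p_range beta c_pos p_lim] D_nonneg
      unfolding D_def L_def \<gamma>_def by simp
    \<comment> \<open>Continuity of \<open>ln\<close> at \<open>L > 0\<close> turns closeness of
      \<open>W\<close> to \<open>L\<close> into closeness of the logarithms; the other half of
      \<open>\<delta>\<close> is reserved for the drift \<open>r\<close>.\<close>
    have "isCont ln L" using L by (intro isCont_ln) simp
    then obtain \<kappa> where \<kappa>: "0 < \<kappa>" "\<And>w. \<bar>w - L\<bar> < \<kappa> \<Longrightarrow> \<bar>ln w - ln L\<bar> < \<delta> / 2"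
      using \<delta> unfolding continuous_at_eps_delta dist_real_def by (meson half_gt_zero)
    have "(\<lambda>N. real (N\<^sup>2) * p N * s N - \<beta>\<^sup>2 / (8 * p N)) \<longlonglongrightarrow> - (\<beta> ^ 4 / (192 * c))"
      using edges_ln_cosh_mean_tendsto[OF p_range beta c_pos p_lim] unfolding s_def \<gamma>_def .
    then have "r \<longlonglongrightarrow> - (\<beta> ^ 4 / (192 * c)) + \<beta> ^ 4 / (192 * c)"
      unfolding r_def by (intro tendsto_add tendsto_const)
    then have "r \<longlonglongrightarrow> 0" by simp
    then have r_small: "\<forall>\<^sub>F N in sequentially. \<bar>r N\<bar> < \<delta> / 2"
      using order_tendstoD(2)[OF tendsto_rabs, of r 0 sequentially "\<delta> / 2"] \<delta> by simp
    show ?thesis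
    proof (rule Lim_null_comparison)
      show "(\<lambda>N. D N / \<kappa>\<^sup>2) \<longlonglongrightarrow> 0"
        using tendsto_divide[OF D_lim tendsto_const[of "\<kappa>\<^sup>2"]] \<kappa>(1) by simp
      show "\<forall>\<^sub>F N in sequentially. norm (measure (M N) {\<omega> \<in> space (M N). \<delta> \<le> \<bar>Y N \<omega>\<bar>}) \<le> D N / \<kappa>\<^sup>2"
        using r_small eventually_gt_at_top[of 0]
      proof eventually_elim
        case (elim N)
        interpret prob_space "M N" by (rule prob[OF elim(2)])
        have W_meas' [measurable]: "W N \<in> borel_measurable (M N)" by (rule W_meas[OF elim(2)])
        have D': "has_bochner_integral (M N) (\<lambda>\<omega>. (W N \<omega> - L)\<^sup>2) (D N)"
          using elim(2) by (intro D) simp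
        have "{\<omega> \<in> space (M N). \<delta> \<le> \<bar>Y N \<omega>\<bar>} \<subseteq> {\<omega> \<in> space (M N). \<kappa>\<^sup>2 \<le> (W N \<omega> - L)\<^sup>2}"
        proof safe
          fix \<omega> assume Y: "\<delta> \<le> \<bar>Y N \<omega>\<bar>"
          have "\<kappa> \<le> \<bar>W N \<omega> - L\<bar>"
          proof (rule ccontr)
            assume "\<not> \<kappa> \<le> \<bar>W N \<omega> - L\<bar>"
            then have "\<bar>ln (W N \<omega>) - ln L\<bar> < \<delta> / 2" by (intro \<kappa>(2)) simp
            with elim(1) Y show False unfolding Y_def by linarith
          qed
          then show "\<kappa>\<^sup>2 \<le> (W N \<omega> - L)\<^sup>2"
            using \<kappa>(1) by (simp add: abs_le_square_iff[symmetric])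
        qed
        then have "prob {\<omega> \<in> space (M N). \<delta> \<le> \<bar>Y N \<omega>\<bar>} \<le> prob {\<omega> \<in> space (M N). \<kappa>\<^sup>2 \<le> (W N \<omega> - L)\<^sup>2}"
          by (intro finite_measure_mono) auto
        \<comment> \<open>Chebyshev's bound around \<open>L\<close>, with mean square deviation
          \<open>D N\<close>.\<close>
        also have "\<dots> \<le> (\<integral>\<omega>. (W N \<omega> - L)\<^sup>2 \<partial>M N) / \<kappa>\<^sup>2"
          using D' \<kappa>(1)
          by (intro integral_Markov_inequality_measure[where A="{}"]) (auto simp: has_bochner_integral_iff)
        also have "\<dots> = D N / \<kappa>\<^sup>2"
          using D' by (simp add: has_bochner_integral_iff)
        finally show ?case by simp
      qed
    qed
  qed
  \<comment> \<open>Levy's theorem asks for a real distribution at every index, but nothing is known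
    about \<open>M 0\<close>; the limit law serves as default there.\<close>
  define \<mu> where "\<mu> N = (if N = 0 then centered_normal v else distr (M N) borel (T N))" for N
  have \<mu>_distr: "real_distribution (\<mu> N)" for N
    using real_distribution_centered_normal[OF v] prob_space.real_distribution_distr[OF prob T_meas]
    by (simp add: \<mu>_def)
  have \<mu>_conv: "weak_conv_m \<mu> (centered_normal v)"
  proof (rule levy_continuity[OF \<mu>_distr real_distribution_centered_normal[OF v]])
    fix \<theta>
    have "(\<lambda>N. char (distr (M N) borel (X N)) \<theta>) \<longlonglongrightarrow> of_real (exp (- (\<theta>\<^sup>2 * v) / 2))"
    proof (rule Lim_transform_eventually)
      \<comment> \<open>The frequency is absorbed into the scale \<open>u = \<theta> * s\<close>, so
        the limiting variance is \<open>\<theta>\<^sup>2 * v\<close>.\<close>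
      have "(\<lambda>N. \<theta> * s N) \<longlonglongrightarrow> \<theta> * 0"
        unfolding s_def \<gamma>_def
        by (intro tendsto_mult tendsto_const ln_cosh_gamma_tendsto_0[OF p_range beta c_pos p_lim])
      moreover have "(\<lambda>N. \<theta>\<^sup>2 * (real (N\<^sup>2) * p N * (s N)\<^sup>2)) \<longlonglongrightarrow> \<theta>\<^sup>2 * v"
        unfolding s_def \<gamma>_def v_def
        by (intro tendsto_mult tendsto_const edges_ln_cosh_variance_tendsto[OF p_range beta c_pos p_lim])
      ultimately show "(\<lambda>N. ((1 - p N) *\<^sub>R iexp (- (\<theta> * s N * p N)) + p N *\<^sub>R iexp (\<theta> * s N * (1 - p N))) ^ N\<^sup>2)
          \<longlonglongrightarrow> of_real (exp (- (\<theta>\<^sup>2 * v) / 2))"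
        using p_range
        by (intro centered_bernoulli_char_power_tendsto[where u="\<lambda>N. \<theta> * s N"] p_tendsto_0[OF p_range beta c_pos p_lim])
           (auto simp: power_mult_distrib mult_ac less_imp_le Suc_le_eq)
      show "\<forall>\<^sub>F N in sequentially. ((1 - p N) *\<^sub>R iexp (- (\<theta> * s N * p N)) + p N *\<^sub>R iexp (\<theta> * s N * (1 - p N))) ^ N\<^sup>2
          = char (distr (M N) borel (X N)) \<theta>"
        using eventually_ge_at_top[of 1]
      proof eventually_elim
        case (elim N)
        show ?case
          unfolding X_def S_def by (rule char_centered_edge_sum[OF graph[OF elim], symmetric])
      qed
    qed
    then have XY: "(\<lambda>N. char (distr (M N) borel (\<lambda>\<omega>. X N \<omega> + Y N \<omega>)) \<theta>) \<longlonglongrightarrow> of_real (exp (- (\<theta>\<^sup>2 * v) / 2))"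
      by (intro char_tendsto_slutsky prob X_meas Y_meas Y_lim)
    have "\<forall>\<^sub>F N in sequentially. char (distr (M N) borel (\<lambda>\<omega>. X N \<omega> + Y N \<omega>)) \<theta> = char (\<mu> N) \<theta>"
      using eventually_gt_at_top[of 0]
    proof eventually_elim
      case (elim N)
      have "distr (M N) borel (\<lambda>\<omega>. X N \<omega> + Y N \<omega>) = distr (M N) borel (T N)"
        using T_eq[OF elim] T_meas[OF elim] X_meas[OF elim] Y_meas[OF elim]
        by (intro distr_cong_AE) auto
      with elim show ?case by (simp add: \<mu>_def)
    qed
    with XY show "(\<lambda>N. char (\<mu> N) \<theta>) \<longlonglongrightarrow> char (centered_normal v) \<theta>"
      unfolding char_centered_normal[OF v] by (rule Lim_transform_eventually)
  qed
  have "weak_conv_m (\<lambda>N. distr (M N) borel (T N)) (centered_normal v)"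
    by (rule weak_conv_m_cong_pos[OF _ \<mu>_conv]) (simp add: \<mu>_def)
  moreover have "weak_conv_m (\<lambda>N. distr (M N) borel
              (\<lambda>\<omega>. sqrt (1 - \<beta>) *
                   (Z N \<omega> / (2 ^ N * exp (\<beta>\<^sup>2 * (1 - p N) / (8 * p N) - \<beta> ^ 4 / (192 * c))))))
           (distr std_normal_distribution borel (\<lambda>\<xi>. exp (\<beta>\<^sup>2 * \<xi> / (8 * sqrt c))))"
  proof (rule weak_conv_m_cong_pos)
    \<comment> \<open>The multiplicative form is the image of the additive one under
      \<open>exp\<close>.\<close>
    have "weak_conv_m (\<lambda>N. distr (\<mu> N) borel exp) (distr (centered_normal v) borel exp)"
      by (intro weak_conv_m_distr_continuous \<mu>_distr real_distribution_centered_normal v \<mu>_conv) simp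
    also have "distr (centered_normal v) borel exp
        = distr std_normal_distribution borel (\<lambda>\<xi>. exp (\<beta>\<^sup>2 * \<xi> / (8 * sqrt c)))"
    proof -
      have "sqrt v = \<beta>\<^sup>2 / (8 * sqrt c)"
        using beta c_pos by (intro real_sqrt_unique) (auto simp: v_def power_divide power_mult_distrib)
      then show ?thesis
        unfolding centered_normal_eq_distr[OF v] by (subst distr_distr) (auto simp: comp_def)
    qed
    finally show "weak_conv_m (\<lambda>N. distr (\<mu> N) borel exp)
        (distr std_normal_distribution borel (\<lambda>\<xi>. exp (\<beta>\<^sup>2 * \<xi> / (8 * sqrt c))))" .
    fix N :: nat assume N: "N > 0"
    have "distr (\<mu> N) borel exp = distr (M N) borel (\<lambda>\<omega>. exp (T N \<omega>))"
      using N T_meas[OF N] by (simp add: \<mu>_def distr_distr comp_def)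
    also have "\<dots> = distr (M N) borel (\<lambda>\<omega>. sqrt (1 - \<beta>) *
                   (Z N \<omega> / (2 ^ N * exp (\<beta>\<^sup>2 * (1 - p N) / (8 * p N) - \<beta> ^ 4 / (192 * c)))))"
    proof (rule distr_cong_AE[OF refl refl])
      \<comment> \<open>\<open>exp\<close> undoes \<open>ln\<close> where \<open>Z\<close> is
        positive, which \<open>factor\<close> gives almost surely.\<close>
      show "AE \<omega> in M N. exp (T N \<omega>) = sqrt (1 - \<beta>) *
                   (Z N \<omega> / (2 ^ N * exp (\<beta>\<^sup>2 * (1 - p N) / (8 * p N) - \<beta> ^ 4 / (192 * c))))"
        using factor[OF N]
      proof eventually_elim
        case (elim \<omega>)
        then have Z: "0 < Z N \<omega>" by simp
        have "exp (real N * ln 2) = (2::real) ^ N"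
          by (simp add: exp_of_nat_mult)
        moreover have "exp (1 / 2 * ln (1 - \<beta>)) = sqrt (1 - \<beta>)"
          using beta by (simp add: ln_sqrt[symmetric])
        ultimately show ?case
          using Z unfolding T_def by (simp add: exp_add exp_diff)
      qed
    qed (use T_meas[OF N] Z_meas[OF N] in measurable)
    finally show "distr (\<mu> N) borel exp = distr (M N) borel (\<lambda>\<omega>. sqrt (1 - \<beta>) *
                   (Z N \<omega> / (2 ^ N * exp (\<beta>\<^sup>2 * (1 - p N) / (8 * p N) - \<beta> ^ 4 / (192 * c)))))" .
  qed
  ultimately show ?thesis
    unfolding T_def v_def by simp
qed

end
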